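(* The category $\mathbf{ZHaus}$ of zero-dimensional Hausdorff spaces and continuous maps and the category $\mathbf{mzMaps}$ of maximal Boolean z-maps are dually equivalent.
   Context: Boolean algebras with $0=1$ are allowed. $\mathbf{2}=\{0,1\}$ is the two-element Boolean algebra; $\mathbf{Boole}(A,\mathbf 2)$ is the set of Boolean homomorphisms $A\to\mathbf 2$. $\mathbf{Caba}$ is the category of complete atomic Boolean algebras and complete Boolean homomorphisms; $\mathrm{At}(B)$ is the set of atoms of $B$. $\mathrm{CO}(X)$ is the set of clopen subsets of a space $X$. $\mathbf{ZHaus}$ is the category of all zero-dimensional Hausdorff spaces (Hausdorff spaces having a base of clopen sets) and all continuous maps. For a Boolean algebra $A$ and $a\in A$, put $s_A(a)=\{x\in \mathbf{Boole}(A,\mathbf 2)\mid x(a)=1\}$; the Stone space $\mathsf S(A)$ is $\mathbf{Boole}(A,\mathbf 2)$ with the topology having $\{s_A(a)\mid a\in A\}$ as a base. For $X\subseteq \mathbf{Boole}(A,\mathbf 2)$ put $s_A^X(a)=X\cap s_A(a)$. For a Boolean homomorphism $\alpha:A\to B$ and $x\in\mathrm{At}(B)$, let $\alpha_x:A\to\mathbf 2$ be the Boolean homomorphism with $\alpha_x(a)=1\Leftrightarrow x\le\alpha(a)$; put $X_\alpha=\{\alpha_x\mid x\in\mathrm{At}(B)\}$. For a Boolean algebra $A$ and $B\in\mathbf{Caba}$, a Boolean monomorphism $\alpha:A\to B$ is a Boolean z-map if every atom of $B$ is a meet of some elements of $\alpha(A)$. It is a maximal Boolean z-map (mz-map) if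 moreover $\mathrm{CO}(X_\alpha)=s_A^{X_\alpha}(A)$, where $X_\alpha$ is a subspace of $\mathsf S(A)$. $\mathbf{mzMaps}$ is the category whose objects are all mz-maps and whose morphisms from $\alpha:A\to B$ to $\alpha':A'\to B'$ are all pairs $(\varphi,\sigma)$ with $\varphi:A\to A'$ a Boolean homomorphism, $\sigma:B\to B'$ a complete Boolean homomorphism and $\alpha'\circ\varphi=\sigma\circ\alpha$; composition is componentwise and identities are $(id_A,id_B)$. Two categories are dually equivalent if there are contravariant functors between them in both directions whose two composites are naturally isomorphic to the identity functors. *)

theory Defs
  imports "HOL-Analysis.Analysis" "HOL-Algebra.Complete_Lattice"
begin

section \<open>Categories and dual equivalence\<close>

text \<open>
  Hom-sets need not be disjoint, so composition and the arrow parts of functors take the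
  objects involved as arguments: \<open>Comp C X Y Z g f\<close> is the composite of \<open>f : X \<rightarrow> Y\<close>
  and \<open>g : Y \<rightarrow> Z\<close>.
\<close>

record ('o, 'm) cat =
  Ob :: "'o set"
  Hom :: "'o \<Rightarrow> 'o \<Rightarrow> 'm set"
  Ident :: "'o \<Rightarrow> 'm"
  Comp :: "'o \<Rightarrow> 'o \<Rightarrow> 'o \<Rightarrow> 'm \<Rightarrow> 'm \<Rightarrow> 'm"

definition category :: "('o, 'm) cat \<Rightarrow> bool" where
  "category C \<longleftrightarrow>
     (\<forall>X\<in>Ob C. Ident C X \<in> Hom C X X) \<and>
     (\<forall>X\<in>Ob C. \<forall>Y\<in>Ob C. \<forall>Z\<in>Ob C. \<forall>f\<in>Hom C X Y. \<forall>g\<in>Hom C Y Z.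
        Comp C X Y Z g f \<in> Hom C X Z) \<and>
     (\<forall>X\<in>Ob C. \<forall>Y\<in>Ob C. \<forall>f\<in>Hom C X Y.
        Comp C X X Y f (Ident C X) = f \<and> Comp C X Y Y (Ident C Y) f = f) \<and>
     (\<forall>W\<in>Ob C. \<forall>X\<in>Ob C. \<forall>Y\<in>Ob C. \<forall>Z\<in>Ob C.
        \<forall>f\<in>Hom C W X. \<forall>g\<in>Hom C X Y. \<forall>h\<in>Hom C Y Z.
        Comp C W X Z (Comp C X Y Z h g) f = Comp C W Y Z h (Comp C W X Y g f))"

definition iso_in :: "('o, 'm) cat \<Rightarrow> 'o \<Rightarrow> 'o \<Rightarrow> 'm \<Rightarrow> bool" where
  "iso_in C X Y f \<longleftrightarrow> f \<in> Hom C X Y \<and>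
     (\<exists>g\<in>Hom C Y X. Comp C X Y X g f = Ident C X \<and> Comp C Y X Y f g = Ident C Y)"

record ('o, 'm, 'p, 'n) fun_data =
  on_ob :: "'o \<Rightarrow> 'p"
  on_hom :: "'o \<Rightarrow> 'o \<Rightarrow> 'm \<Rightarrow> 'n"

definition contravariant_functor ::
  "('o, 'm) cat \<Rightarrow> ('p, 'n) cat \<Rightarrow> ('o, 'm, 'p, 'n) fun_data \<Rightarrow> bool" where
  "contravariant_functor C D F \<longleftrightarrow>
     (\<forall>X\<in>Ob C. on_ob F X \<in> Ob D) \<and>
     (\<forall>X\<in>Ob C. \<forall>Y\<in>Ob C. \<forall>f\<in>Hom C X Y. on_hom F X Y f \<in> Hom D (on_ob F Y) (on_ob F X)) \<and>
     (\<forall>X\<in>Ob C. on_hom F X X (Ident C X) = Ident D (on_ob F X)) \<and>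
     (\<forall>X\<in>Ob C. \<forall>Y\<in>Ob C. \<forall>Z\<in>Ob C. \<forall>f\<in>Hom C X Y. \<forall>g\<in>Hom C Y Z.
        on_hom F X Z (Comp C X Y Z g f) =
          Comp D (on_ob F Z) (on_ob F Y) (on_ob F X) (on_hom F X Y f) (on_hom F Y Z g))"

text \<open>The composite \<open>G \<circ> F\<close> of two contravariant functors; it is covariant.\<close>

definition comp_contra ::
  "('p, 'n, 'q, 'k) fun_data \<Rightarrow> ('o, 'm, 'p, 'n) fun_data \<Rightarrow> ('o, 'm, 'q, 'k) fun_data" where
  "comp_contra G F =
     \<lparr> on_ob = (\<lambda>X. on_ob G (on_ob F X)),
       on_hom = (\<lambda>X Y f. on_hom G (on_ob F Y) (on_ob F X) (on_hom F X Y f)) \<rparr>"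

definition id_functor :: "('o, 'm, 'o, 'm) fun_data" where
  "id_functor = \<lparr> on_ob = (\<lambda>X. X), on_hom = (\<lambda>X Y f. f) \<rparr>"

definition naturally_isomorphic ::
  "('o, 'm) cat \<Rightarrow> ('p, 'n) cat \<Rightarrow> ('o, 'm, 'p, 'n) fun_data \<Rightarrow> ('o, 'm, 'p, 'n) fun_data \<Rightarrow> bool"
  where
  "naturally_isomorphic C D F G \<longleftrightarrow>
     (\<exists>\<eta>. (\<forall>X\<in>Ob C. iso_in D (on_ob F X) (on_ob G X) (\<eta> X)) \<and>
        (\<forall>X\<in>Ob C. \<forall>Y\<in>Ob C. \<forall>f\<in>Hom C X Y.
           Comp D (on_ob F X) (on_ob F Y) (on_ob G Y) (\<eta> Y) (on_hom F X Y f) =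
           Comp D (on_ob F X) (on_ob G X) (on_ob G Y) (on_hom G X Y f) (\<eta> X)))"

definition dually_equivalent :: "('o, 'm) cat \<Rightarrow> ('p, 'n) cat \<Rightarrow> bool" where
  "dually_equivalent C D \<longleftrightarrow> category C \<and> category D \<and>
     (\<exists>F G. contravariant_functor C D F \<and> contravariant_functor D C G \<and>
        naturally_isomorphic C C (comp_contra G F) id_functor \<and>
        naturally_isomorphic D D (comp_contra F G) id_functor)"


section \<open>Boolean algebras\<close>

locale boolean_lattice = bounded_lattice +
  assumes meet_join_distrib:
      "\<lbrakk>x \<in> carrier L; y \<in> carrier L; z \<in> carrier L\<rbrakk> \<Longrightarrow>
        x \<sqinter> (y \<squnion> z) = (x \<sqinter> y) \<squnion> (x \<sqinter> z)"
    and complement_exists: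
      "x \<in> carrier L \<Longrightarrow> \<exists>y\<in>carrier L. x \<sqinter> y = \<bottom> \<and> x \<squnion> y = \<top>"

text \<open>Maps between carriers are extensional, so that equality of maps is equality on the domain.
  Preservation of complements is a consequence.\<close>

definition boolean_hom :: "'a gorder \<Rightarrow> 'b gorder \<Rightarrow> ('a \<Rightarrow> 'b) set" where
  "boolean_hom A B = {f \<in> carrier A \<rightarrow>\<^sub>E carrier B.
     f \<bottom>\<^bsub>A\<^esub> = \<bottom>\<^bsub>B\<^esub> \<and> f \<top>\<^bsub>A\<^esub> = \<top>\<^bsub>B\<^esub> \<and>
     (\<forall>x\<in>carrier A. \<forall>y\<in>carrier A.
        f (x \<sqinter>\<^bsub>A\<^esub> y) = f x \<sqinter>\<^bsub>B\<^esub> f y \<and> f (x \<squnion>\<^bsub>A\<^esub> y) = f x \<squnion>\<^bsub>B\<^esub> f y)}"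

definition complete_boolean_hom :: "'a gorder \<Rightarrow> 'b gorder \<Rightarrow> ('a \<Rightarrow> 'b) set" where
  "complete_boolean_hom A B = {f \<in> boolean_hom A B.
     \<forall>S. S \<subseteq> carrier A \<longrightarrow>
       f (\<Sqinter>\<^bsub>A\<^esub> S) = \<Sqinter>\<^bsub>B\<^esub> (f ` S) \<and> f (\<Squnion>\<^bsub>A\<^esub> S) = \<Squnion>\<^bsub>B\<^esub> (f ` S)}"

definition atoms :: "'a gorder \<Rightarrow> 'a set" where
  "atoms B = {x \<in> carrier B. x \<noteq> \<bottom>\<^bsub>B\<^esub> \<and>
     (\<forall>y\<in>carrier B. y \<sqsubseteq>\<^bsub>B\<^esub> x \<longrightarrow> y = \<bottom>\<^bsub>B\<^esub> \<or> y = x)}"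

definition caba :: "'a gorder \<Rightarrow> bool" where
  "caba B \<longleftrightarrow> boolean_lattice B \<and> complete_lattice B \<and>
     (\<forall>b\<in>carrier B. b \<noteq> \<bottom>\<^bsub>B\<^esub> \<longrightarrow> (\<exists>x\<in>atoms B. x \<sqsubseteq>\<^bsub>B\<^esub> b))"

definition two :: "bool gorder" where
  "two = \<lparr> carrier = UNIV, eq = (=), le = (\<le>) \<rparr>"


section \<open>Stone spaces and mz-maps\<close>

definition clopens :: "'a topology \<Rightarrow> 'a set set" where
  "clopens X = {U. openin X U \<and> closedin X U}"

definition s_map :: "'a gorder \<Rightarrow> 'a \<Rightarrow> ('a \<Rightarrow> bool) set" where
  "s_map A a = {x \<in> boolean_hom A two. x a = True}"

definition stone_space :: "'a gorder \<Rightarrow> ('a \<Rightarrow> bool) topology" where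
  "stone_space A = topology (arbitrary union_of (\<lambda>U. U \<in> s_map A ` carrier A))"

definition atom_hom :: "'a gorder \<Rightarrow> 'b gorder \<Rightarrow> ('a \<Rightarrow> 'b) \<Rightarrow> 'b \<Rightarrow> ('a \<Rightarrow> bool)" where
  "atom_hom A B \<alpha> x = (\<lambda>a\<in>carrier A. x \<sqsubseteq>\<^bsub>B\<^esub> \<alpha> a)"

definition atom_homs :: "'a gorder \<Rightarrow> 'b gorder \<Rightarrow> ('a \<Rightarrow> 'b) \<Rightarrow> ('a \<Rightarrow> bool) set" where
  "atom_homs A B \<alpha> = atom_hom A B \<alpha> ` atoms B"

definition boolean_z_map :: "'a gorder \<Rightarrow> 'b gorder \<Rightarrow> ('a \<Rightarrow> 'b) \<Rightarrow> bool" where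
  "boolean_z_map A B \<alpha> \<longleftrightarrow> boolean_lattice A \<and> caba B \<and>
     \<alpha> \<in> boolean_hom A B \<and> inj_on \<alpha> (carrier A) \<and>
     (\<forall>x\<in>atoms B. \<exists>S\<subseteq>\<alpha> ` carrier A. x = \<Sqinter>\<^bsub>B\<^esub> S)"

definition mz_map :: "'a gorder \<Rightarrow> 'b gorder \<Rightarrow> ('a \<Rightarrow> 'b) \<Rightarrow> bool" where
  "mz_map A B \<alpha> \<longleftrightarrow> boolean_z_map A B \<alpha> \<and>
     clopens (subtopology (stone_space A) (atom_homs A B \<alpha>)) =
       (\<lambda>a. atom_homs A B \<alpha> \<inter> s_map A a) ` carrier A"

definition zero_dimensional :: "'a topology \<Rightarrow> bool" where
  "zero_dimensional X \<longleftrightarrow>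
     (\<exists>\<B>. \<B> \<subseteq> clopens X \<and> openin X = arbitrary union_of (\<lambda>U. U \<in> \<B>))"


section \<open>The two categories\<close>

text \<open>
  HOL has no type containing all spaces or all Boolean algebras, so ``all'' is read relative to
  a universe: objects live on subsets of a type \<open>'u\<close>, of which some are designated as small.
  Small sets are closed under passing to sets of at most the same cardinality, and power sets of
  small sets exist in \<open>'u\<close> up to bijection. Spaces are required to have a small point set, and
  mz-maps \<open>A \<rightarrow> B\<close> a small set of atoms of \<open>B\<close>, the size of \<open>A\<close> and \<open>B\<close> then being that of
  the power set of a small set at most.

  The two lemmas on instances show that smallness can be bounded by an arbitrary type \<open>'s\<close>, so that
  every space and every mz-map is covered up to relabelling of points and elements, and that it
  can be read as in a Grothendieck universe (cardinality below a strong limit). In the latter case,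
  by \<open>small_atoms_iff\<close>, the condition on atoms says precisely that \<open>B\<close> (hence \<open>A\<close>) is small.
\<close>

definition universe :: "('u set \<Rightarrow> bool) \<Rightarrow> bool" where
  "universe small \<longleftrightarrow>
     (\<forall>S T. small T \<and> S \<lesssim> T \<longrightarrow> small S) \<and>
     (\<forall>S. small S \<longrightarrow> Pow S \<lesssim> (UNIV :: 'u set))"

lemma universe_bounded_by_type:
  "universe (\<lambda>S :: 's set set. S \<lesssim> (UNIV :: 's set))"
  unfolding universe_def
proof (intro conjI allI impI)
  fix S :: "'s set set" assume "S \<lesssim> (UNIV :: 's set)"
  then obtain f :: "'s set \<Rightarrow> 's" where "inj_on f S"
    unfolding lepoll_def by blast
  then have "inj_on ((`) f) (Pow S)"
    by (rule inj_on_image_Pow)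
  then show "Pow S \<lesssim> (UNIV :: 's set set)"
    unfolding lepoll_def by blast
qed (blast intro: lepoll_trans)

lemma universe_strong_limit:
  assumes "\<And>S :: 'u set. S \<prec> (UNIV :: 'u set) \<Longrightarrow> Pow S \<prec> (UNIV :: 'u set)"
  shows "universe (\<lambda>S :: 'u set. S \<prec> (UNIV :: 'u set))"
  unfolding universe_def using assms by (blast intro: lesspoll_trans1 lesspoll_imp_lepoll)

definition ZHaus :: "('u set \<Rightarrow> bool) \<Rightarrow> ('u topology, 'u \<Rightarrow> 'u) cat" where
  "ZHaus small =
     \<lparr> Ob = {X. Hausdorff_space X \<and> zero_dimensional X \<and> small (topspace X)},
       Hom = (\<lambda>X Y. {f \<in> extensional (topspace X). continuous_map X Y f}),
       Ident = (\<lambda>X. restrict id (topspace X)),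
       Comp = (\<lambda>X Y Z g f. compose (topspace X) g f) \<rparr>"

type_synonym 'u alg_map = "'u gorder \<times> 'u gorder \<times> ('u \<Rightarrow> 'u)"

definition mzMaps ::
  "('u set \<Rightarrow> bool) \<Rightarrow> ('u alg_map, ('u \<Rightarrow> 'u) \<times> ('u \<Rightarrow> 'u)) cat" where
  "mzMaps small =
     \<lparr> Ob = {(A, B, \<alpha>). mz_map A B \<alpha> \<and> small (atoms B)},
       Hom = (\<lambda>(A, B, \<alpha>) (A', B', \<alpha>').
         {(\<phi>, \<sigma>). \<phi> \<in> boolean_hom A A' \<and> \<sigma> \<in> complete_boolean_hom B B' \<and>
           compose (carrier A) \<alpha>' \<phi> = compose (carrier A) \<sigma> \<alpha>}),
       Ident = (\<lambda>(A, B, \<alpha>). (restrict id (carrier A), restrict id (carrier B))),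
       Comp = (\<lambda>(A, B, \<alpha>) (A', B', \<alpha>') (A'', B'', \<alpha>'') (\<phi>', \<sigma>') (\<phi>, \<sigma>).
         (compose (carrier A) \<phi>' \<phi>, compose (carrier B) \<sigma>' \<sigma>)) \<rparr>"

lemma caba_lepoll_Pow_atoms:
  assumes "caba B"
  shows "carrier B \<lesssim> Pow (atoms B)"
proof -
  interpret boolean_lattice B using assms by (simp add: caba_def)
  let ?h = "\<lambda>b. {x \<in> atoms B. x \<sqsubseteq>\<^bsub>B\<^esub> b}"
  have le: "b \<sqsubseteq>\<^bsub>B\<^esub> c" if b: "b \<in> carrier B" and c: "c \<in> carrier B" and sub: "?h b \<subseteq> ?h c" for b c
  proof -
    obtain d where d: "d \<in> carrier B" "c \<sqinter>\<^bsub>B\<^esub> d = \<bottom>\<^bsub>B\<^esub>" "c \<squnion>\<^bsub>B\<^esub> d = \<top>\<^bsub>B\<^esub>"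
      using complement_exists[OF c] by blast
    have "b \<sqinter>\<^bsub>B\<^esub> d = \<bottom>\<^bsub>B\<^esub>"
    proof (rule ccontr)
      assume "b \<sqinter>\<^bsub>B\<^esub> d \<noteq> \<bottom>\<^bsub>B\<^esub>"
      then obtain x where x: "x \<in> atoms B" "x \<sqsubseteq>\<^bsub>B\<^esub> b \<sqinter>\<^bsub>B\<^esub> d"
        using assms b d(1) unfolding caba_def by (meson meet_closed)
      then have xc: "x \<in> carrier B" "x \<noteq> \<bottom>\<^bsub>B\<^esub>" by (auto simp: atoms_def)
      have "x \<sqsubseteq>\<^bsub>B\<^esub> b" "x \<sqsubseteq>\<^bsub>B\<^esub> d"
        using x(2) xc b d(1) by (meson le_trans meet_closed meet_left meet_right)+
      moreover have "x \<sqsubseteq>\<^bsub>B\<^esub> c" using x(1) \<open>x \<sqsubseteq>\<^bsub>B\<^esub> b\<close> sub by blast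
      ultimately have "x \<sqsubseteq>\<^bsub>B\<^esub> \<bottom>\<^bsub>B\<^esub>" using meet_le[of x c d] xc c d by simp
      then show False using xc by (meson bottom_closed bottom_lower le_antisym)
    qed
    then have "b \<sqinter>\<^bsub>B\<^esub> (c \<squnion>\<^bsub>B\<^esub> d) = (b \<sqinter>\<^bsub>B\<^esub> c) \<squnion>\<^bsub>B\<^esub> \<bottom>\<^bsub>B\<^esub>"
      using meet_join_distrib[OF b c d(1)] by simp
    also have "b \<sqinter>\<^bsub>B\<^esub> (c \<squnion>\<^bsub>B\<^esub> d) = b"
      using b d(3) by (metis le_refl meet_le meet_left top_closed top_higher le_antisym meet_closed)
    also have "(b \<sqinter>\<^bsub>B\<^esub> c) \<squnion>\<^bsub>B\<^esub> \<bottom>\<^bsub>B\<^esub> = b \<sqinter>\<^bsub>B\<^esub> c"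
      using b c by (meson bottom_closed bottom_lower join_closed join_le join_left le_antisym le_refl
          meet_closed)
    finally have "b \<sqinter>\<^bsub>B\<^esub> c = b" by simp
    then show ?thesis using b c by (metis meet_right)
  qed
  have "inj_on ?h (carrier B)"
  proof (rule inj_onI)
    fix b c assume "b \<in> carrier B" "c \<in> carrier B" "?h b = ?h c"
    then show "b = c" using le[of b c] le[of c b] le_antisym by simp
  qed
  moreover have "?h ` carrier B \<subseteq> Pow (atoms B)" by blast
  ultimately show ?thesis unfolding lepoll_def by blast
qed

lemma small_atoms_iff:
  assumes "universe small" and "\<And>S. small S \<Longrightarrow> \<exists>T. small T \<and> Pow S \<lesssim> T" and "caba B"
  shows "small (atoms B) \<longleftrightarrow> small (carrier B)"
proof
  assume "small (atoms B)"
  then obtain T where "small T" "Pow (atoms B) \<lesssim> T" using assms(2) by blast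
  then show "small (carrier B)"
    using assms(1) caba_lepoll_Pow_atoms[OF assms(3)] lepoll_trans unfolding universe_def by blast
next
  assume "small (carrier B)"
  moreover have "atoms B \<lesssim> carrier B" by (rule subset_imp_lepoll) (auto simp: atoms_def)
  ultimately show "small (atoms B)" using assms(1) unfolding universe_def by blast
qed

end

theory Submission
  imports Defs
begin

text \<open>
  Tarski duality makes the complete homomorphisms \<open>B \<rightarrow> B'\<close> correspond to the maps
  \<open>At(B') \<rightarrow> At(B)\<close>. For an mz-map \<open>\<alpha> : A \<rightarrow> B\<close>, give \<open>At(B)\<close> the topology
  with base \<open>{x. x \<le> \<alpha>(a)}\<close> for \<open>a \<in> A\<close>; maximality says that these basic sets are all
  the clopen sets, so \<open>\<alpha>\<close> is, up to isomorphism, the inclusion of the clopen sets of \<open>At(B)\<close>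
  into its power set. A complete homomorphism \<open>\<sigma>\<close> then restricts to the clopen algebras, that is,
  extends to a morphism \<open>(\<phi>, \<sigma>)\<close>, exactly if its dual map of atoms is continuous, and \<open>\<phi>\<close> is
  determined by \<open>\<sigma>\<close> because \<open>\<alpha>'\<close> is injective. Hence \<open>\<alpha> \<mapsto> At(B)\<close> is fully faithful. It is
  essentially surjective because the inclusion of the clopen sets of a zero-dimensional
  Hausdorff space into its power set is an mz-map whose space of atoms is the given space.
\<close>

section \<open>Dual equivalence from a fully faithful functor\<close>

lemma ident_in_Hom: "\<lbrakk>category C; X \<in> Ob C\<rbrakk> \<Longrightarrow> Ident C X \<in> Hom C X X"
  by (simp add: category_def)

lemma Comp_in_Hom:
  "\<lbrakk>category C; X \<in> Ob C; Y \<in> Ob C; Z \<in> Ob C; f \<in> Hom C X Y; g \<in> Hom C Y Z\<rbrakk> \<Longrightarrow>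
    Comp C X Y Z g f \<in> Hom C X Z"
  by (simp add: category_def)

lemma Comp_Ident_right:
  "\<lbrakk>category C; X \<in> Ob C; Y \<in> Ob C; f \<in> Hom C X Y\<rbrakk> \<Longrightarrow> Comp C X X Y f (Ident C X) = f"
  by (simp add: category_def)

lemma Comp_Ident_left:
  "\<lbrakk>category C; X \<in> Ob C; Y \<in> Ob C; f \<in> Hom C X Y\<rbrakk> \<Longrightarrow> Comp C X Y Y (Ident C Y) f = f"
  by (simp add: category_def)

lemma Comp_assoc:
  "\<lbrakk>category C; W \<in> Ob C; X \<in> Ob C; Y \<in> Ob C; Z \<in> Ob C;
    f \<in> Hom C W X; g \<in> Hom C X Y; h \<in> Hom C Y Z\<rbrakk> \<Longrightarrow>
    Comp C W X Z (Comp C X Y Z h g) f = Comp C W Y Z h (Comp C W X Y g f)"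
  by (simp add: category_def)

lemma iso_in_left_cancel:
  assumes "category C" "W \<in> Ob C" "X \<in> Ob C" "Y \<in> Ob C" "iso_in C X Y h"
    and "f \<in> Hom C W X" "g \<in> Hom C W X" "Comp C W X Y h f = Comp C W X Y h g"
  shows "f = g"
proof -
  obtain k where k: "k \<in> Hom C Y X" "Comp C X Y X k h = Ident C X" and h: "h \<in> Hom C X Y"
    using assms(5) by (auto simp: iso_in_def)
  have "u = Comp C W Y X k (Comp C W X Y h u)" if "u \<in> Hom C W X" for u
    using Comp_assoc[OF assms(1,2,3,4,3) that h k(1)] Comp_Ident_left[OF assms(1,2,3) that] k(2)
    by simp
  then show ?thesis using assms(6-8) by metis
qed

lemma contravariant_functor_Ob:
  "\<lbrakk>contravariant_functor C D F; X \<in> Ob C\<rbrakk> \<Longrightarrow> on_ob F X \<in> Ob D"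
  by (simp add: contravariant_functor_def)

lemma contravariant_functor_Hom:
  "\<lbrakk>contravariant_functor C D F; X \<in> Ob C; Y \<in> Ob C; f \<in> Hom C X Y\<rbrakk> \<Longrightarrow>
    on_hom F X Y f \<in> Hom D (on_ob F Y) (on_ob F X)"
  by (simp add: contravariant_functor_def)

lemma contravariant_functor_Ident:
  "\<lbrakk>contravariant_functor C D F; X \<in> Ob C\<rbrakk> \<Longrightarrow> on_hom F X X (Ident C X) = Ident D (on_ob F X)"
  by (simp add: contravariant_functor_def)

lemma contravariant_functor_Comp:
  "\<lbrakk>contravariant_functor C D F; X \<in> Ob C; Y \<in> Ob C; Z \<in> Ob C; f \<in> Hom C X Y; g \<in> Hom C Y Z\<rbrakk> \<Longrightarrow>
    on_hom F X Z (Comp C X Y Z g f) =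
      Comp D (on_ob F Z) (on_ob F Y) (on_ob F X) (on_hom F X Y f) (on_hom F Y Z g)"
  by (simp add: contravariant_functor_def)

text \<open>Essential surjectivity chooses for each \<open>X\<close> an object \<open>P X\<close>
  and an isomorphism \<open>e X\<close> from \<open>G (P X)\<close> to \<open>X\<close>. Full
  faithfulness leaves exactly one arrow part \<open>L\<close> that makes \<open>e\<close> natural;
  \<open>P\<close> and \<open>L\<close> form the functor \<open>F\<close>. Then \<open>e\<close> is
  the isomorphism of \<open>G \<circ> F\<close> with the identity, and reflecting inverses of
  \<open>e\<close> along \<open>G\<close> gives the one for \<open>F \<circ> G\<close>.\<close>

theorem dually_equivalentI_fully_faithful:
  assumes C: "category C" and D: "category D" and G: "contravariant_functor D C G"
    and ff: "\<And>X Y. \<lbrakk>X \<in> Ob D; Y \<in> Ob D\<rbrakk> \<Longrightarrow>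
      bij_betw (on_hom G X Y) (Hom D X Y) (Hom C (on_ob G Y) (on_ob G X))"
    and eso: "\<And>X. X \<in> Ob C \<Longrightarrow> \<exists>Y\<in>Ob D. \<exists>f. iso_in C (on_ob G Y) X f"
  shows "dually_equivalent C D"
proof -
  let ?G = "on_ob G"
  note GOb [simp] = contravariant_functor_Ob[OF G] and GHom [simp] = contravariant_functor_Hom[OF G]
    and GComp = contravariant_functor_Comp[OF G] and GIdent = contravariant_functor_Ident[OF G]
  note CC [simp] = Comp_in_Hom[OF C] and CD [simp] = Comp_in_Hom[OF D]
  have faithful: "f = g" if "X \<in> Ob D" "Y \<in> Ob D" "f \<in> Hom D X Y" "g \<in> Hom D X Y"
    "on_hom G X Y f = on_hom G X Y g" for X Y f g
    using ff[OF that(1,2)] that(3-) by (auto simp: bij_betw_def inj_on_def)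
  have full: "\<exists>f\<in>Hom D X Y. on_hom G X Y f = g" if "X \<in> Ob D" "Y \<in> Ob D" "g \<in> Hom C (?G Y) (?G X)"
    for X Y g
    using ff[OF that(1,2)] that(3) unfolding bij_betw_def by (metis imageE)
  have "\<forall>X. \<exists>Y f. X \<in> Ob C \<longrightarrow> Y \<in> Ob D \<and> iso_in C (?G Y) X f"
    using eso by blast
  then obtain P e where "\<forall>X. X \<in> Ob C \<longrightarrow> P X \<in> Ob D \<and> iso_in C (?G (P X)) X (e X)"
    by metis
  then have P [simp]: "\<And>X. X \<in> Ob C \<Longrightarrow> P X \<in> Ob D"
    and iso: "\<And>X. X \<in> Ob C \<Longrightarrow> iso_in C (?G (P X)) X (e X)" by auto
  then have e [simp]: "\<And>X. X \<in> Ob C \<Longrightarrow> e X \<in> Hom C (?G (P X)) X"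
    by (simp add: iso_in_def)
  \<comment> \<open>A chosen inverse \<open>d X\<close> of \<open>e X\<close>.\<close>
  have "\<forall>X. \<exists>d. X \<in> Ob C \<longrightarrow> d \<in> Hom C X (?G (P X)) \<and>
      Comp C (?G (P X)) X (?G (P X)) d (e X) = Ident C (?G (P X)) \<and>
      Comp C X (?G (P X)) X (e X) d = Ident C X"
    using iso by (meson iso_in_def)
  then obtain d where "\<forall>X. X \<in> Ob C \<longrightarrow> d X \<in> Hom C X (?G (P X)) \<and>
      Comp C (?G (P X)) X (?G (P X)) (d X) (e X) = Ident C (?G (P X)) \<and>
      Comp C X (?G (P X)) X (e X) (d X) = Ident C X"
    by metis
  then have d [simp]: "\<And>X. X \<in> Ob C \<Longrightarrow> d X \<in> Hom C X (?G (P X))"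
    and de: "\<And>X. X \<in> Ob C \<Longrightarrow> Comp C (?G (P X)) X (?G (P X)) (d X) (e X) = Ident C (?G (P X))"
    and ed: "\<And>X. X \<in> Ob C \<Longrightarrow> Comp C X (?G (P X)) X (e X) (d X) = Ident C X"
    by auto
  \<comment> \<open>The image of \<open>g\<close> under \<open>G\<close> has to be the conjugate
    \<open>d Y \<circ> f \<circ> e X\<close>; fullness supplies such a \<open>g\<close>, and
    \<open>e Y \<circ> d Y = id\<close> closes the naturality square.\<close>
  have "\<exists>g\<in>Hom D (P Y) (P X). Comp C (?G (P X)) (?G (P Y)) Y (e Y) (on_hom G (P Y) (P X) g) =
      Comp C (?G (P X)) X Y f (e X)"
    if f: "X \<in> Ob C" "Y \<in> Ob C" "f \<in> Hom C X Y" for X Y f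
  proof -
    let ?h = "Comp C (?G (P X)) X Y f (e X)"
    have h: "?h \<in> Hom C (?G (P X)) Y" using f by simp
    then obtain g where g: "g \<in> Hom D (P Y) (P X)"
      "on_hom G (P Y) (P X) g = Comp C (?G (P X)) Y (?G (P Y)) (d Y) ?h"
      using full[of "P Y" "P X" "Comp C (?G (P X)) Y (?G (P Y)) (d Y) ?h"] f h by auto
    have "Comp C (?G (P X)) (?G (P Y)) Y (e Y) (on_hom G (P Y) (P X) g) = ?h"
      using Comp_assoc[OF C _ _ _ _ h d e] Comp_Ident_left[OF C _ _ h] ed f g(2) by simp
    with g(1) show ?thesis by blast
  qed
  then obtain L where
    "\<forall>X Y f. X \<in> Ob C \<and> Y \<in> Ob C \<and> f \<in> Hom C X Y \<longrightarrow> L X Y f \<in> Hom D (P Y) (P X) \<and>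
      Comp C (?G (P X)) (?G (P Y)) Y (e Y) (on_hom G (P Y) (P X) (L X Y f)) =
      Comp C (?G (P X)) X Y f (e X)"
    by metis
  then have L [simp]: "\<And>X Y f. \<lbrakk>X \<in> Ob C; Y \<in> Ob C; f \<in> Hom C X Y\<rbrakk> \<Longrightarrow> L X Y f \<in> Hom D (P Y) (P X)"
    and eL: "\<And>X Y f. \<lbrakk>X \<in> Ob C; Y \<in> Ob C; f \<in> Hom C X Y\<rbrakk> \<Longrightarrow>
      Comp C (?G (P X)) (?G (P Y)) Y (e Y) (on_hom G (P Y) (P X) (L X Y f)) =
      Comp C (?G (P X)) X Y f (e X)"
    by auto
  \<comment> \<open>Uniqueness of \<open>L\<close>: the isomorphism \<open>e Y\<close> can be
    cancelled and \<open>G\<close> is faithful. The functor laws for \<open>L\<close> thus reduce to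
    checking that the expected arrow closes a naturality square.\<close>
  have L_eqI: "L X Y f = g"
    if "X \<in> Ob C" "Y \<in> Ob C" "f \<in> Hom C X Y" "g \<in> Hom D (P Y) (P X)"
      "Comp C (?G (P X)) (?G (P Y)) Y (e Y) (on_hom G (P Y) (P X) g) = Comp C (?G (P X)) X Y f (e X)"
    for X Y f g
    by (rule faithful[of "P Y" "P X"], use that in simp_all)
      (rule iso_in_left_cancel[OF C _ _ _ iso[of Y], of "?G (P X)"], use that eL in simp_all)
  define F where "F = \<lparr> on_ob = P, on_hom = L \<rparr>"
  have F: "contravariant_functor C D F"
    unfolding contravariant_functor_def F_def
  proof (intro conjI ballI; simp)
    fix X assume X: "X \<in> Ob C"
    show "L X X (Ident C X) = Ident D (P X)"
      using X ident_in_Hom[OF C] ident_in_Hom[OF D]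
      by (intro L_eqI) (simp_all add: GIdent Comp_Ident_left[OF C] Comp_Ident_right[OF C])
  next
    fix X Y Z f g
    assume *: "X \<in> Ob C" "Y \<in> Ob C" "Z \<in> Ob C" "f \<in> Hom C X Y" "g \<in> Hom C Y Z"
    let ?f = "on_hom G (P Y) (P X) (L X Y f)" and ?g = "on_hom G (P Z) (P Y) (L Y Z g)"
    \<comment> \<open>Pasting the naturality squares of \<open>f\<close> and \<open>g\<close> gives
      the square of their composite.\<close>
    have "Comp C (?G (P X)) (?G (P Z)) Z (e Z) (Comp C (?G (P X)) (?G (P Y)) (?G (P Z)) ?g ?f) =
        Comp C (?G (P X)) (?G (P Y)) Z (Comp C (?G (P Y)) (?G (P Z)) Z (e Z) ?g) ?f"
      using * by (simp add: Comp_assoc[OF C])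
    also have "\<dots> = Comp C (?G (P X)) Y Z g (Comp C (?G (P X)) (?G (P Y)) Y (e Y) ?f)"
      using * by (simp add: eL Comp_assoc[OF C])
    also have "\<dots> = Comp C (?G (P X)) X Z (Comp C X Y Z g f) (e X)"
      using * by (simp add: eL Comp_assoc[OF C])
    finally show "L X Z (Comp C X Y Z g f) = Comp D (P Z) (P Y) (P X) (L X Y f) (L Y Z g)"
      using * by (intro L_eqI) (simp_all add: GComp)
  qed
  have GF: "naturally_isomorphic C C (comp_contra G F) id_functor"
    unfolding naturally_isomorphic_def
    by (rule exI[of _ e]) (simp add: comp_contra_def id_functor_def F_def iso eL)
  \<comment> \<open>\<open>G\<close> reverses arrows, so a morphism
    \<open>P (G X) \<rightarrow> X\<close> comes from one
    \<open>G X \<rightarrow> G (P (G X))\<close>, for which the inverse \<open>d\<close> of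
    \<open>e\<close> at \<open>G X\<close> is taken.\<close>
  have "\<forall>X. \<exists>t. X \<in> Ob D \<longrightarrow> t \<in> Hom D (P (?G X)) X \<and> on_hom G (P (?G X)) X t = d (?G X)"
    using full[OF P _ d] GOb by blast
  then obtain t where "\<forall>X. X \<in> Ob D \<longrightarrow> t X \<in> Hom D (P (?G X)) X \<and>
      on_hom G (P (?G X)) X (t X) = d (?G X)"
    by metis
  then have t [simp]: "\<And>X. X \<in> Ob D \<Longrightarrow> t X \<in> Hom D (P (?G X)) X"
    and Gt: "\<And>X. X \<in> Ob D \<Longrightarrow> on_hom G (P (?G X)) X (t X) = d (?G X)"
    by auto
  have t_iso: "iso_in D (P (?G X)) X (t X)" if X: "X \<in> Ob D" for X
  proof -
    \<comment> \<open>The inverse of \<open>t X\<close> is the arrow that \<open>G\<close> sends to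
      \<open>e (G X)\<close>; faithfulness reflects the two inverse laws.\<close>
    obtain s where s: "s \<in> Hom D X (P (?G X))" "on_hom G X (P (?G X)) s = e (?G X)"
      using full[of X "P (?G X)" "e (?G X)"] X by auto
    have "Comp D (P (?G X)) X (P (?G X)) s (t X) = Ident D (P (?G X))"
      by (rule faithful[of "P (?G X)" "P (?G X)"])
        (use X s ident_in_Hom[OF D] in \<open>simp_all add: GComp GIdent Gt de\<close>)
    moreover have "Comp D X (P (?G X)) X (t X) s = Ident D X"
      by (rule faithful[of X X])
        (use X s ident_in_Hom[OF D] in \<open>simp_all add: GComp GIdent Gt ed\<close>)
    ultimately show ?thesis using X s by (auto simp: iso_in_def)
  qed
  have t_nat: "Comp D (P (?G X)) (P (?G Y)) Y (t Y) (L (?G Y) (?G X) (on_hom G X Y f)) =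
      Comp D (P (?G X)) X Y f (t X)"
    if "X \<in> Ob D" "Y \<in> Ob D" "f \<in> Hom D X Y" for X Y f
  proof (rule faithful[of "P (?G X)" Y])
    let ?X = "?G X" and ?Y = "?G Y" and ?f = "on_hom G X Y f"
    let ?l = "on_hom G (P ?X) (P ?Y) (L ?Y ?X ?f)"
    \<comment> \<open>Under \<open>G\<close> the naturality square of \<open>t\<close> becomes that
      of \<open>d\<close>, which follows from naturality of \<open>e\<close> after cancelling
      \<open>e ?X\<close>.\<close>
    have "Comp C ?Y (?G (P ?Y)) (?G (P ?X)) ?l (d ?Y) = Comp C ?Y ?X (?G (P ?X)) (d ?X) ?f"
    proof (rule iso_in_left_cancel[OF C _ _ _ iso[of ?X], of ?Y])
      have "Comp C ?Y (?G (P ?X)) ?X (e ?X) (Comp C ?Y (?G (P ?Y)) (?G (P ?X)) ?l (d ?Y)) =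
        Comp C ?Y (?G (P ?Y)) ?X (Comp C (?G (P ?Y)) (?G (P ?X)) ?X (e ?X) ?l) (d ?Y)"
        using that by (simp add: Comp_assoc[OF C])
      also have "\<dots> = Comp C ?Y ?Y ?X ?f (Comp C ?Y (?G (P ?Y)) ?Y (e ?Y) (d ?Y))"
        using that by (simp add: eL Comp_assoc[OF C])
      also have "\<dots> = ?f" using that by (simp add: ed Comp_Ident_right[OF C])
      also have "\<dots> = Comp C ?Y ?X ?X (Comp C ?X (?G (P ?X)) ?X (e ?X) (d ?X)) ?f"
        using that by (simp add: ed Comp_Ident_left[OF C])
      also have "\<dots> = Comp C ?Y (?G (P ?X)) ?X (e ?X) (Comp C ?Y ?X (?G (P ?X)) (d ?X) ?f)"
        using that by (simp add: Comp_assoc[OF C])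
      finally show "Comp C ?Y (?G (P ?X)) ?X (e ?X) (Comp C ?Y (?G (P ?Y)) (?G (P ?X)) ?l (d ?Y)) =
        Comp C ?Y (?G (P ?X)) ?X (e ?X) (Comp C ?Y ?X (?G (P ?X)) (d ?X) ?f)" .
    qed (use that in simp_all)
    then show "on_hom G (P ?X) Y (Comp D (P ?X) (P ?Y) Y (t Y) (L ?Y ?X ?f)) =
        on_hom G (P ?X) Y (Comp D (P ?X) X Y f (t X))"
      using that by (simp add: GComp Gt)
  qed (use that in simp_all)
  have "naturally_isomorphic D D (comp_contra F G) id_functor"
    unfolding naturally_isomorphic_def
    by (rule exI[of _ t]) (simp add: comp_contra_def id_functor_def F_def t_iso t_nat)
  then show ?thesis
    unfolding dually_equivalent_def using C D F G GF by blast
qed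

section \<open>Complete atomic Boolean algebras\<close>

text \<open>The Tarski representation of an element as a set of atoms. For a complete atomic
  \<open>B\<close> it is an isomorphism onto the power set of \<open>atoms B\<close>.\<close>

definition below :: "'a gorder \<Rightarrow> 'a \<Rightarrow> 'a set" where
  "below B b = {x \<in> atoms B. x \<sqsubseteq>\<^bsub>B\<^esub> b}"

locale complete_atomic = fixes L (structure) assumes caba: "caba L"

sublocale complete_atomic \<subseteq> boolean_lattice L
  using caba by (simp add: caba_def)

sublocale complete_atomic \<subseteq> complete_lattice L
  using caba by (simp add: caba_def)

lemma atom_in_carrier: "x \<in> atoms L \<Longrightarrow> x \<in> carrier L"
  by (simp add: atoms_def)

lemma below_subset_atoms: "below L b \<subseteq> atoms L"
  by (auto simp: below_def)

section \<open>Representation of elements by sets of atoms\<close>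

context complete_atomic
begin

text \<open>Atoms are join-prime: \<open>x \<sqinter> a\<close> lies below the atom
  \<open>x\<close>, so it is \<open>x\<close> or bottom, and in the latter case distributivity puts
  \<open>x\<close> below \<open>b\<close>.\<close>

lemma atom_le_join:
  assumes x: "x \<in> atoms L" and ab: "a \<in> carrier L" "b \<in> carrier L" and le: "x \<sqsubseteq> a \<squnion> b"
  shows "x \<sqsubseteq> a \<or> x \<sqsubseteq> b"
proof -
  have xL: "x \<in> carrier L" using x by (rule atom_in_carrier)
  consider "x \<sqinter> a = \<bottom>" | "x \<sqinter> a = x"
    using x ab xL meet_left[of x a] by (auto simp: atoms_def)
  then show ?thesis
  proof cases
    case 1
    have "x = (x \<sqinter> a) \<squnion> (x \<sqinter> b)"
      using le ab xL meet_join_distrib le_iff_join join_closed by metis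
    also have "\<dots> \<sqsubseteq> b"
      unfolding 1 using ab xL by (intro join_le bottom_lower meet_right) simp_all
    finally show ?thesis by simp
  next
    case 2
    then show ?thesis using meet_right[OF xL ab(1)] by simp
  qed
qed

lemma not_atom_le_bottom: "x \<in> atoms L \<Longrightarrow> \<not> x \<sqsubseteq> \<bottom>"
  by (auto simp: atoms_def dest: le_antisym[OF _ bottom_lower])

lemma atom_le_atom: "\<lbrakk>x \<in> atoms L; y \<in> atoms L; x \<sqsubseteq> y\<rbrakk> \<Longrightarrow> x = y"
  by (auto simp: atoms_def)

lemma below_atom: "x \<in> atoms L \<Longrightarrow> below L x = {x}"
  by (auto simp: below_def atom_in_carrier dest: atom_le_atom)

lemma below_bottom: "below L \<bottom> = {}"
  by (auto simp: below_def not_atom_le_bottom)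

lemma below_top: "below L \<top> = atoms L"
  by (auto simp: below_def atom_in_carrier)

lemma below_mono:
  "\<lbrakk>b \<in> carrier L; c \<in> carrier L; b \<sqsubseteq> c\<rbrakk> \<Longrightarrow> below L b \<subseteq> below L c"
  by (auto simp: below_def intro: le_trans dest: atom_in_carrier)

lemma below_meet:
  assumes "b \<in> carrier L" "c \<in> carrier L"
  shows "below L (b \<sqinter> c) = below L b \<inter> below L c"
proof
  show "below L (b \<sqinter> c) \<subseteq> below L b \<inter> below L c"
    using assms by (intro Int_greatest below_mono meet_left meet_right) simp_all
qed (use assms in \<open>auto simp: below_def atom_in_carrier intro: meet_le\<close>)

lemma below_join:
  assumes "b \<in> carrier L" "c \<in> carrier L"
  shows "below L (b \<squnion> c) = below L b \<union> below L c"
proof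
  show "below L b \<union> below L c \<subseteq> below L (b \<squnion> c)"
    using assms by (intro Un_least below_mono join_left join_right) simp_all
qed (use assms in \<open>auto simp: below_def dest: atom_le_join\<close>)

text \<open>For the converse, let \<open>d\<close> be a complement of \<open>c\<close>. No atom lies
  below \<open>b \<sqinter> d\<close>, so atomicity makes this meet bottom, and distributing
  \<open>b\<close> over \<open>c \<squnion> d\<close> puts \<open>b\<close> below
  \<open>c\<close>.\<close>

lemma le_iff_below:
  assumes b: "b \<in> carrier L" and c: "c \<in> carrier L"
  shows "b \<sqsubseteq> c \<longleftrightarrow> below L b \<subseteq> below L c"
proof
  assume sub: "below L b \<subseteq> below L c"
  obtain d where d: "d \<in> carrier L" "c \<sqinter> d = \<bottom>" "c \<squnion> d = \<top>"
    using complement_exists[OF c] by blast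
  have "below L (b \<sqinter> d) \<subseteq> below L (c \<sqinter> d)"
    using sub by (auto simp: below_meet b c d(1))
  then have "below L (b \<sqinter> d) = {}" by (simp add: d(2) below_bottom)
  then have *: "b \<sqinter> d = \<bottom>"
    using caba meet_closed[OF b d(1)] unfolding caba_def below_def by blast
  have "b = b \<sqinter> (c \<squnion> d)" using b d(3) le_iff_join[OF b top_closed] top_higher[OF b] by simp
  also have "\<dots> = (b \<sqinter> c) \<squnion> \<bottom>" using * meet_join_distrib[OF b c d(1)] by simp
  also have "\<dots> \<sqsubseteq> c" using b c by (intro join_le bottom_lower meet_right) simp_all
  finally show "b \<sqsubseteq> c" .
qed (rule below_mono[OF b c])

lemma below_inject:
  "\<lbrakk>b \<in> carrier L; c \<in> carrier L; below L b = below L c\<rbrakk> \<Longrightarrow> b = c"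
  by (simp add: le_antisym le_iff_below)

text \<open>The intersection with \<open>atoms L\<close> matters for empty \<open>S\<close>, whose
  infimum is the top element.\<close>

lemma below_Inf:
  assumes S: "S \<subseteq> carrier L"
  shows "below L (\<Sqinter>S) = atoms L \<inter> (\<Inter>s\<in>S. below L s)"
proof
  show "below L (\<Sqinter>S) \<subseteq> atoms L \<inter> (\<Inter>s\<in>S. below L s)"
    using S by (intro Int_greatest INT_greatest below_subset_atoms below_mono inf_lower inf_closed) auto
qed (auto simp: below_def atom_in_carrier intro!: inf_greatest[OF S])

text \<open>Atoms are completely join-prime. If \<open>x\<close> is below no member of
  \<open>S\<close>, then every member lies below the complement \<open>d\<close> of
  \<open>x\<close>, because all atoms other than \<open>x\<close> do; hence
  \<open>\<Squnion>S \<sqsubseteq> d\<close>, which an atom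
  \<open>x \<sqsubseteq> \<Squnion>S\<close> contradicts.\<close>

lemma below_Sup:
  assumes S: "S \<subseteq> carrier L"
  shows "below L (\<Squnion>S) = (\<Union>s\<in>S. below L s)"
proof
  show "(\<Union>s\<in>S. below L s) \<subseteq> below L (\<Squnion>S)"
    using S by (intro UN_least below_mono sup_upper) auto
next
  show "below L (\<Squnion>S) \<subseteq> (\<Union>s\<in>S. below L s)"
  proof
    fix x assume "x \<in> below L (\<Squnion>S)"
    then have x: "x \<in> atoms L" and le: "x \<sqsubseteq> \<Squnion>S" by (auto simp: below_def)
    have xL: "x \<in> carrier L" using x by (rule atom_in_carrier)
    show "x \<in> (\<Union>s\<in>S. below L s)"
    proof (rule ccontr)
      assume x_notin: "x \<notin> (\<Union>s\<in>S. below L s)"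
      obtain d where d: "d \<in> carrier L" "x \<sqinter> d = \<bottom>" "x \<squnion> d = \<top>"
        using complement_exists[OF xL] by blast
      have "below L x \<union> below L d = atoms L" "below L x \<inter> below L d = {}"
        using below_join[OF xL d(1)] below_meet[OF xL d(1)] d below_top below_bottom by simp_all
      then have below_d: "below L d = atoms L - {x}"
        using below_atom[OF x] by blast
      have "\<Squnion>S \<sqsubseteq> d"
      proof (rule sup_least[OF S d(1)])
        fix s assume "s \<in> S"
        then show "s \<sqsubseteq> d"
          using S d(1) x_notin below_d below_subset_atoms[of L s] by (subst le_iff_below) auto
      qed
      then have "x \<in> below L d"
        using le xL x d(1) S by (auto simp: below_def intro: le_trans)
      then show False by (simp add: below_d)
    qed
  qed
qed

text \<open>Together with \<open>Sup_below\<close> this makes suprema of sets of atoms the inverse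
  of \<open>below L\<close>: every set of atoms is represented.\<close>

lemma below_Sup_atoms:
  assumes "T \<subseteq> atoms L"
  shows "below L (\<Squnion>T) = T"
proof -
  have "T \<subseteq> carrier L" using assms by (auto simp: atoms_def)
  then have "below L (\<Squnion>T) = (\<Union>x\<in>T. below L x)" by (rule below_Sup)
  also have "\<dots> = (\<Union>x\<in>T. {x})" using assms below_atom by (intro SUP_cong) auto
  finally show ?thesis by simp
qed

lemma Sup_below:
  assumes "b \<in> carrier L"
  shows "\<Squnion>(below L b) = b"
proof (rule below_inject)
  show "\<Squnion>(below L b) \<in> carrier L"
    by (rule sup_closed) (auto simp: below_def atoms_def)
qed (simp_all add: assms below_Sup_atoms below_subset_atoms)

end

section \<open>Homomorphisms\<close>

lemma boolean_homD:
  assumes "f \<in> boolean_hom A B"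
  shows "f \<in> extensional (carrier A)" "x \<in> carrier A \<Longrightarrow> f x \<in> carrier B"
    "f \<bottom>\<^bsub>A\<^esub> = \<bottom>\<^bsub>B\<^esub>" "f \<top>\<^bsub>A\<^esub> = \<top>\<^bsub>B\<^esub>"
    "\<lbrakk>x \<in> carrier A; y \<in> carrier A\<rbrakk> \<Longrightarrow> f (x \<sqinter>\<^bsub>A\<^esub> y) = f x \<sqinter>\<^bsub>B\<^esub> f y"
    "\<lbrakk>x \<in> carrier A; y \<in> carrier A\<rbrakk> \<Longrightarrow> f (x \<squnion>\<^bsub>A\<^esub> y) = f x \<squnion>\<^bsub>B\<^esub> f y"
  using assms by (auto simp: boolean_hom_def PiE_def)

lemma complete_boolean_homD:
  assumes "f \<in> complete_boolean_hom A B"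
  shows "f \<in> boolean_hom A B"
    "S \<subseteq> carrier A \<Longrightarrow> f (\<Sqinter>\<^bsub>A\<^esub> S) = \<Sqinter>\<^bsub>B\<^esub> (f ` S)"
    "S \<subseteq> carrier A \<Longrightarrow> f (\<Squnion>\<^bsub>A\<^esub> S) = \<Squnion>\<^bsub>B\<^esub> (f ` S)"
  using assms by (auto simp: complete_boolean_hom_def)

lemma restrict_id_boolean_hom:
  "boolean_lattice A \<Longrightarrow> restrict id (carrier A) \<in> boolean_hom A A"
proof -
  assume "boolean_lattice A"
  then interpret boolean_lattice A .
  show ?thesis by (simp add: boolean_hom_def)
qed

lemma restrict_id_complete_boolean_hom:
  "caba B \<Longrightarrow> restrict id (carrier B) \<in> complete_boolean_hom B B"
proof -
  assume B: "caba B"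
  then interpret complete_atomic B by unfold_locales
  have "restrict id (carrier B) ` S = S" if "S \<subseteq> carrier B" for S
    using that by (force simp: image_iff)
  then show ?thesis
    using B restrict_id_boolean_hom[of B] by (simp add: complete_boolean_hom_def caba_def)
qed

lemma compose_boolean_hom:
  assumes A: "boolean_lattice A" and f: "f \<in> boolean_hom A B" and g: "g \<in> boolean_hom B C"
  shows "compose (carrier A) g f \<in> boolean_hom A C"
proof -
  interpret boolean_lattice A by (rule A)
  show ?thesis
    using boolean_homD[OF f] boolean_homD[OF g]
    by (auto simp: boolean_hom_def compose_eq PiE_def compose_extensional)
qed

lemma compose_complete_boolean_hom:
  assumes A: "caba A" and f: "f \<in> complete_boolean_hom A B" and g: "g \<in> complete_boolean_hom B C"
  shows "compose (carrier A) g f \<in> complete_boolean_hom A C"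
proof -
  interpret complete_atomic A using A by unfold_locales
  have *: "compose (carrier A) g f ` S = g ` f ` S" "f ` S \<subseteq> carrier B" if "S \<subseteq> carrier A" for S
    using that boolean_homD(2)[OF complete_boolean_homD(1)[OF f]]
    by (force simp: compose_def image_iff subset_iff)+
  have "compose (carrier A) g f \<in> boolean_hom A C"
    using A f g by (intro compose_boolean_hom) (auto simp: caba_def complete_boolean_hom_def)
  then show ?thesis
    using * complete_boolean_homD[OF f] complete_boolean_homD[OF g]
    by (auto simp: complete_boolean_hom_def compose_eq)
qed

text \<open>The factor is \<open>f\<close> followed by the inverse of \<open>g\<close>. Since
  \<open>g\<close> is injective, each law for \<open>h\<close> can be checked after applying
  \<open>g\<close>, where it is a law for \<open>f\<close>. This produces the component
  \<open>\<phi>\<close> of a morphism from \<open>\<sigma>\<close>.\<close>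

lemma boolean_hom_through_injective:
  assumes A: "boolean_lattice A" and A': "boolean_lattice A'"
    and f: "f \<in> boolean_hom A B" and g: "g \<in> boolean_hom A' B" "inj_on g (carrier A')"
    and sub: "f ` carrier A \<subseteq> g ` carrier A'"
  obtains h where "h \<in> boolean_hom A A'" "compose (carrier A) g h = f"
proof -
  interpret A: boolean_lattice A by (rule A)
  interpret A': boolean_lattice A' by (rule A')
  define h where "h = (\<lambda>a\<in>carrier A. inv_into (carrier A') g (f a))"
  have h: "h a \<in> carrier A'" "g (h a) = f a" if "a \<in> carrier A" for a
    using that sub by (auto simp: h_def f_inv_into_f intro!: inv_into_into)
  have h_eqI: "h a = c" if "a \<in> carrier A" "c \<in> carrier A'" "g c = f a" for a c
    using that h[of a] g(2) by (metis inj_onD)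
  note fD = boolean_homD[OF f] and gD = boolean_homD[OF g(1)]
  have "h \<in> carrier A \<rightarrow>\<^sub>E carrier A'"
    using h(1) by (auto simp: h_def)
  then have "h \<in> boolean_hom A A'"
    unfolding boolean_hom_def
    by (intro CollectI conjI ballI h_eqI) (simp_all add: h fD gD)
  moreover have "compose (carrier A) g h = f"
    by (rule extensionalityI[OF compose_extensional fD(1)]) (simp add: compose_eq h)
  ultimately show thesis by (rule that)
qed

section \<open>Tarski duality for complete homomorphisms\<close>

text \<open>The Tarski dual of \<open>\<sigma>\<close>: if \<open>\<sigma>\<close> takes preimages
  under a map \<open>f\<close> of points, then a point lies in the preimage of \<open>{x}\<close>
  exactly if \<open>f\<close> sends it to \<open>x\<close>, so this recovers \<open>f\<close>. For
  complete homomorphisms the description is unique by \<open>ex1_atom_map\<close>.\<close>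

definition atom_map :: "'a gorder \<Rightarrow> 'b gorder \<Rightarrow> ('a \<Rightarrow> 'b) \<Rightarrow> 'b \<Rightarrow> 'a" where
  "atom_map B B' \<sigma> = (\<lambda>x'\<in>atoms B'. THE x. x \<in> atoms B \<and> x' \<sqsubseteq>\<^bsub>B'\<^esub> \<sigma> x)"

context
  fixes B :: "'a gorder" and B' :: "'b gorder"
  assumes B: "caba B" and B': "caba B'"
begin

interpretation B: complete_atomic B using B by unfold_locales
interpretation B': complete_atomic B' using B' by unfold_locales

text \<open>The last hypothesis says that \<open>\<sigma>\<close> is the preimage operation of
  \<open>f\<close> when elements are read as sets of atoms. Preimages commute with all unions and
  intersections, and \<open>below B'\<close> is injective, so the identities hold for
  \<open>\<sigma>\<close> itself.\<close>

lemma complete_boolean_homI_atoms: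
  assumes \<sigma>: "\<sigma> \<in> carrier B \<rightarrow>\<^sub>E carrier B'" and f: "f \<in> atoms B' \<rightarrow> atoms B"
    and below_\<sigma>: "\<And>b. b \<in> carrier B \<Longrightarrow> below B' (\<sigma> b) = {x \<in> atoms B'. f x \<in> below B b}"
  shows "\<sigma> \<in> complete_boolean_hom B B'"
proof -
  have \<sigma>c: "\<sigma> b \<in> carrier B'" if "b \<in> carrier B" for b using that \<sigma> by auto
  have \<sigma>_eqI: "\<sigma> b = c" if "b \<in> carrier B" "c \<in> carrier B'"
    "below B' c = {x \<in> atoms B'. f x \<in> below B b}" for b c
    using that below_\<sigma> by (intro B'.below_inject \<sigma>c) simp_all
  have img: "\<sigma> ` S \<subseteq> carrier B'" if "S \<subseteq> carrier B" for S using that \<sigma>c by auto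
  have "\<sigma> (\<Sqinter>\<^bsub>B\<^esub> S) = \<Sqinter>\<^bsub>B'\<^esub> (\<sigma> ` S)" if S: "S \<subseteq> carrier B" for S
  proof (rule \<sigma>_eqI[OF B.inf_closed[OF S] B'.inf_closed[OF img[OF S]]])
    show "below B' (\<Sqinter>\<^bsub>B'\<^esub> (\<sigma> ` S)) = {x \<in> atoms B'. f x \<in> below B (\<Sqinter>\<^bsub>B\<^esub> S)}"
      unfolding B.below_Inf[OF S] B'.below_Inf[OF img[OF S]]
      using f by (auto simp: S[THEN subsetD] below_\<sigma>)
  qed
  moreover have "\<sigma> (\<Squnion>\<^bsub>B\<^esub> S) = \<Squnion>\<^bsub>B'\<^esub> (\<sigma> ` S)" if S: "S \<subseteq> carrier B" for S
  proof (rule \<sigma>_eqI[OF B.sup_closed[OF S] B'.sup_closed[OF img[OF S]]])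
    show "below B' (\<Squnion>\<^bsub>B'\<^esub> (\<sigma> ` S)) = {x \<in> atoms B'. f x \<in> below B (\<Squnion>\<^bsub>B\<^esub> S)}"
      unfolding B.below_Sup[OF S] B'.below_Sup[OF img[OF S]]
      using f by (auto simp: S[THEN subsetD] below_\<sigma>)
  qed
  moreover have "\<sigma> \<bottom>\<^bsub>B\<^esub> = \<bottom>\<^bsub>B'\<^esub>" "\<sigma> \<top>\<^bsub>B\<^esub> = \<top>\<^bsub>B'\<^esub>"
    using f by (auto intro!: \<sigma>_eqI simp: B.below_bottom B'.below_bottom B.below_top B'.below_top)
  \<comment> \<open>Binary meets and joins are by definition infima and suprema of pairs, so these
    cases are covered as well.\<close>
  ultimately show ?thesis
    using \<sigma> by (simp add: complete_boolean_hom_def boolean_hom_def meet_def join_def)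
qed

context
  fixes \<sigma> assumes \<sigma>: "\<sigma> \<in> complete_boolean_hom B B'"
begin

text \<open>Existence: the top of \<open>B\<close> is the join of all atoms and
  \<open>\<sigma>\<close> preserves this join, so the completely join-prime \<open>x'\<close> is
  below some \<open>\<sigma> x\<close>. Uniqueness: distinct atoms have meet bottom, hence so have
  their images.\<close>

lemma ex1_atom_map:
  assumes x': "x' \<in> atoms B'"
  shows "\<exists>!x. x \<in> atoms B \<and> x' \<sqsubseteq>\<^bsub>B'\<^esub> \<sigma> x"
proof -
  note \<sigma>D = boolean_homD[OF complete_boolean_homD(1)[OF \<sigma>]]
  have "x' \<in> below B' (\<sigma> (\<Squnion>\<^bsub>B\<^esub> (below B \<top>\<^bsub>B\<^esub>)))"
    using x' B'.below_top by (simp add: B.Sup_below \<sigma>D)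
  also have "\<sigma> (\<Squnion>\<^bsub>B\<^esub> (below B \<top>\<^bsub>B\<^esub>)) = \<Squnion>\<^bsub>B'\<^esub> (\<sigma> ` atoms B)"
    unfolding B.below_top by (rule complete_boolean_homD(3)[OF \<sigma>]) (auto simp: atoms_def)
  also have "below B' \<dots> = (\<Union>x\<in>atoms B. below B' (\<sigma> x))"
    by (subst B'.below_Sup) (auto simp: \<sigma>D atom_in_carrier)
  finally obtain x where x: "x \<in> atoms B" "x' \<sqsubseteq>\<^bsub>B'\<^esub> \<sigma> x" by (auto simp: below_def)
  moreover have "y = x" if y: "y \<in> atoms B" "x' \<sqsubseteq>\<^bsub>B'\<^esub> \<sigma> y" for y
  proof (rule ccontr)
    assume "y \<noteq> x"
    then have "below B (x \<sqinter>\<^bsub>B\<^esub> y) = below B \<bottom>\<^bsub>B\<^esub>"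
      using x y by (simp add: B.below_meet B.below_atom B.below_bottom atom_in_carrier)
    then have "\<sigma> x \<sqinter>\<^bsub>B'\<^esub> \<sigma> y = \<bottom>\<^bsub>B'\<^esub>"
      using x y \<sigma>D B.below_inject[of "x \<sqinter>\<^bsub>B\<^esub> y" "\<bottom>\<^bsub>B\<^esub>"] by (metis B.meet_closed B.bottom_closed atom_in_carrier)
    moreover have "x' \<in> below B' (\<sigma> x) \<inter> below B' (\<sigma> y)"
      using x y x' by (simp add: below_def)
    ultimately show False
      using x(1) y(1) B'.below_bottom
      by (simp add: \<sigma>D atom_in_carrier flip: B'.below_meet)
  qed
  ultimately show ?thesis by blast
qed

lemma atom_map_eq_iff:
  "\<lbrakk>x' \<in> atoms B'; x \<in> atoms B\<rbrakk> \<Longrightarrow> atom_map B B' \<sigma> x' = x \<longleftrightarrow> x' \<sqsubseteq>\<^bsub>B'\<^esub> \<sigma> x"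
  using theI'[OF ex1_atom_map, of x'] ex1_atom_map[of x'] by (auto simp: atom_map_def)

lemma atom_map_in_atoms: "x' \<in> atoms B' \<Longrightarrow> atom_map B B' \<sigma> x' \<in> atoms B"
  using theI'[OF ex1_atom_map, of x'] by (auto simp: atom_map_def)

text \<open>Converse to \<open>complete_boolean_homI_atoms\<close>: every complete homomorphism is a
  preimage operation. As \<open>b\<close> is the join of the atoms below it and
  \<open>\<sigma>\<close> preserves joins, it suffices to look at atoms, where
  \<open>atom_map_eq_iff\<close> applies.\<close>

lemma below_complete_boolean_hom:
  assumes b: "b \<in> carrier B"
  shows "below B' (\<sigma> b) = {x' \<in> atoms B'. atom_map B B' \<sigma> x' \<in> below B b}"
proof -
  note \<sigma>D = boolean_homD[OF complete_boolean_homD(1)[OF \<sigma>]]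
  have sub: "below B b \<subseteq> carrier B" by (auto simp: below_def atom_in_carrier)
  have "\<sigma> b = \<sigma> (\<Squnion>\<^bsub>B\<^esub> (below B b))" by (simp add: B.Sup_below b)
  also have "\<dots> = \<Squnion>\<^bsub>B'\<^esub> (\<sigma> ` below B b)" by (rule complete_boolean_homD(3)[OF \<sigma> sub])
  finally have "below B' (\<sigma> b) = below B' (\<Squnion>\<^bsub>B'\<^esub> (\<sigma> ` below B b))" by simp
  also have "\<dots> = (\<Union>s\<in>\<sigma> ` below B b. below B' s)"
    by (rule B'.below_Sup) (use sub \<sigma>D(2) in auto)
  also have "\<dots> = {x' \<in> atoms B'. atom_map B B' \<sigma> x' \<in> below B b}"
    by (auto simp: below_def atom_map_in_atoms simp flip: atom_map_eq_iff)
  finally show ?thesis .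
qed

end

end

section \<open>The space of atoms of a Boolean z-map\<close>

lemma complete_lattice_two: "complete_lattice two"
proof
  show "\<exists>s. least two s (Upper two S)" if "S \<subseteq> carrier two" for S
    by (rule exI[of _ "True \<in> S"]) (auto simp: least_def Upper_def two_def)
  show "\<exists>s. greatest two s (Lower two S)" if "S \<subseteq> carrier two" for S
    by (rule exI[of _ "\<forall>b\<in>S. b"]) (auto simp: greatest_def Lower_def two_def)
qed (auto simp: two_def)

text \<open>The lattice operations are chosen by their order properties; the laws of a complete
  lattice identify them with the connectives.\<close>

lemma two_simps:
  "x \<sqinter>\<^bsub>two\<^esub> y \<longleftrightarrow> x \<and> y" "x \<squnion>\<^bsub>two\<^esub> y \<longleftrightarrow> x \<or> y" "\<top>\<^bsub>two\<^esub> \<longleftrightarrow> True" "\<bottom>\<^bsub>two\<^esub> \<longleftrightarrow> False"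
proof -
  interpret complete_lattice two by (rule complete_lattice_two)
  show "x \<sqinter>\<^bsub>two\<^esub> y \<longleftrightarrow> x \<and> y"
    using meet_left[of x y] meet_right[of x y] meet_le[of "x \<and> y" x y] by (auto simp: two_def)
  show "x \<squnion>\<^bsub>two\<^esub> y \<longleftrightarrow> x \<or> y"
    using join_left[of x y] join_right[of x y] join_le[of x "x \<or> y" y] by (auto simp: two_def)
  show "\<top>\<^bsub>two\<^esub> \<longleftrightarrow> True" using top_higher[of True] by (auto simp: two_def)
  show "\<bottom>\<^bsub>two\<^esub> \<longleftrightarrow> False" using bottom_lower[of False] by (auto simp: two_def)
qed

lemma carrier_two: "carrier two = UNIV"
  by (simp add: two_def)

lemma s_map_meet:
  assumes "a \<in> carrier A" "b \<in> carrier A"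
  shows "s_map A (a \<sqinter>\<^bsub>A\<^esub> b) = s_map A a \<inter> s_map A b"
  using assms by (auto simp: s_map_def boolean_homD(5) two_simps)

text \<open>The basic sets are closed under binary intersection by \<open>s_map_meet\<close>, so
  their unions do form a topology and \<open>topology\<close> returns it unchanged.\<close>

lemma openin_stone_space:
  assumes "boolean_lattice A"
  shows "openin (stone_space A) = arbitrary union_of (\<lambda>U. U \<in> s_map A ` carrier A)"
proof -
  interpret boolean_lattice A by (rule assms)
  show ?thesis
    unfolding stone_space_def
    by (rule topology_inverse', rule istopology_base) (auto simp flip: s_map_meet)
qed

lemma topspace_stone_space:
  assumes "boolean_lattice A"
  shows "topspace (stone_space A) = boolean_hom A two"
proof
  interpret boolean_lattice A by (rule assms)
  have "openin (stone_space A) (s_map A \<top>\<^bsub>A\<^esub>)"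
    unfolding openin_stone_space[OF assms] by (rule arbitrary_union_of_inc) simp
  moreover have "s_map A \<top>\<^bsub>A\<^esub> = boolean_hom A two"
    by (auto simp: s_map_def boolean_homD(4) two_simps)
  ultimately show "boolean_hom A two \<subseteq> topspace (stone_space A)"
    using openin_subset by fastforce
  have "\<Union>\<U> \<subseteq> boolean_hom A two" if "\<U> \<subseteq> s_map A ` carrier A" for \<U>
    using that by (fastforce simp: s_map_def)
  then show "topspace (stone_space A) \<subseteq> boolean_hom A two"
    using openin_topspace[of "stone_space A"]
    by (fastforce simp: openin_stone_space[OF assms] union_of_def arbitrary_def)
qed

section \<open>Topologies pulled back along a map\<close>

lemma openin_pullback_topology_base:
  assumes "openin T = arbitrary union_of (\<lambda>U. U \<in> \<B>)"
  shows "openin (pullback_topology S f T) = arbitrary union_of (\<lambda>U. U \<in> (\<lambda>V. f -` V \<inter> S) ` \<B>)"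
  unfolding openin_topology_base_unique openin_pullback_topology
proof (intro conjI allI impI)
  show "\<exists>U. openin T U \<and> V = f -` U \<inter> S" if "V \<in> (\<lambda>V. f -` V \<inter> S) ` \<B>" for V
    using that assms unfolding openin_topology_base_unique by blast
next
  fix U x assume "(\<exists>V. openin T V \<and> U = f -` V \<inter> S) \<and> x \<in> U"
  then obtain V where V: "openin T V" "U = f -` V \<inter> S" "x \<in> S" "f x \<in> V" by blast
  then obtain W where "W \<in> \<B>" "f x \<in> W" "W \<subseteq> V"
    using assms unfolding openin_topology_base_unique by meson
  then show "\<exists>V. V \<in> (\<lambda>V. f -` V \<inter> S) ` \<B> \<and> x \<in> V \<and> V \<subseteq> U"
    using V by (intro exI[of _ "f -` W \<inter> S"]) blast
qed

lemma clopens_pullback_topology: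
  assumes f: "f ` S \<subseteq> topspace T"
  shows "clopens (pullback_topology S f T) = (\<lambda>V. f -` V \<inter> S) ` clopens (subtopology T (f ` S))"
    (is "clopens ?P = ?pre ` clopens ?T")
proof -
  have top: "topspace ?P = S" "topspace ?T = f ` S"
    using f by (auto simp: topspace_pullback_topology)
  have op: "openin ?P U \<longleftrightarrow> (\<exists>V. openin ?T V \<and> U = ?pre V)" for U
    unfolding openin_pullback_topology openin_subtopology by blast
  have clop: "U \<in> clopens ?P \<longleftrightarrow> openin ?P U \<and> openin ?P (S - U)"
      "V \<in> clopens ?T \<longleftrightarrow> openin ?T V \<and> openin ?T (f ` S - V)" for U V
    unfolding clopens_def closedin_def top using openin_subset top by blast+
  have diff: "S - ?pre V = ?pre (f ` S - V)" for V by blast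
  show ?thesis
  proof (intro subset_antisym subsetI)
    fix U assume "U \<in> clopens ?P"
    then have "openin ?P U" "openin ?P (S - U)" by (simp_all add: clop)
    then obtain V W where V: "openin ?T V" "U = ?pre V" and W: "openin ?T W" "S - U = ?pre W"
      unfolding op by blast
    have "V \<subseteq> f ` S" "W \<subseteq> f ` S" using V(1) W(1) openin_subset top(2) by blast+
    \<comment> \<open>Subsets of the image are determined by their preimages, and those of
      \<open>V\<close> and \<open>W\<close> are complementary in \<open>S\<close>.\<close>
    then have "f ` S - V = W" using V(2) W(2) by blast
    then have "V \<in> clopens ?T" using V(1) W(1) by (simp add: clop)
    then show "U \<in> ?pre ` clopens ?T" using V(2) by blast
  next
    fix U assume "U \<in> ?pre ` clopens ?T"
    then obtain V where V: "U = ?pre V" "openin ?T V" "openin ?T (f ` S - V)"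
      by (auto simp: clop)
    then have "openin ?P U" "openin ?P (S - U)" unfolding op diff V(1) by blast+
    then show "U \<in> clopens ?P" by (simp add: clop)
  qed
qed

section \<open>The topology on the atoms\<close>

text \<open>The subspace X_\<alpha> of the Stone space moved to the atoms, where
  \<open>atom_map\<close> acts. For a Boolean z-map the assignment of \<alpha>_x to \<open>x\<close>
  is injective, since \<open>x\<close> is the meet of the elements of the image of
  \<open>\<alpha>\<close> above it; the result is then a homeomorphic copy of X_\<alpha>.\<close>

definition atom_space :: "'a gorder \<Rightarrow> 'b gorder \<Rightarrow> ('a \<Rightarrow> 'b) \<Rightarrow> 'b topology" where
  "atom_space A B \<alpha> = pullback_topology (atoms B) (atom_hom A B \<alpha>) (stone_space A)"

context
  fixes A :: "'a gorder" and B :: "'b gorder" and \<alpha>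
  assumes A: "boolean_lattice A" and B: "caba B" and \<alpha>: "\<alpha> \<in> boolean_hom A B"
begin

interpretation A: boolean_lattice A by (rule A)
interpretation B: complete_atomic B using B by unfold_locales

lemma atom_hom_iff_below:
  "\<lbrakk>x \<in> atoms B; a \<in> carrier A\<rbrakk> \<Longrightarrow> atom_hom A B \<alpha> x a \<longleftrightarrow> x \<in> below B (\<alpha> a)"
  by (simp add: atom_hom_def below_def)

lemma atom_hom_boolean_hom:
  assumes x: "x \<in> atoms B"
  shows "atom_hom A B \<alpha> x \<in> boolean_hom A two"
proof -
  have "atom_hom A B \<alpha> x \<in> extensional (carrier A)" by (simp add: atom_hom_def)
  then show ?thesis
    using x by (simp add: boolean_hom_def PiE_def two_simps carrier_two atom_hom_iff_below
        boolean_homD[OF \<alpha>] B.below_meet B.below_join B.below_top B.below_bottom)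
qed

lemma atom_hom_vimage_s_map:
  "a \<in> carrier A \<Longrightarrow> atom_hom A B \<alpha> -` s_map A a \<inter> atoms B = below B (\<alpha> a)"
  using below_subset_atoms[of B "\<alpha> a"]
  by (auto simp: s_map_def atom_hom_iff_below atom_hom_boolean_hom)

lemma topspace_atom_space: "topspace (atom_space A B \<alpha>) = atoms B"
  by (auto simp: atom_space_def topspace_pullback_topology topspace_stone_space[OF A] atom_hom_boolean_hom)

lemma openin_atom_space:
  "openin (atom_space A B \<alpha>) = arbitrary union_of (\<lambda>U. U \<in> (\<lambda>a. below B (\<alpha> a)) ` carrier A)"
  unfolding atom_space_def openin_pullback_topology_base[OF openin_stone_space[OF A]] image_image
  by (simp add: atom_hom_vimage_s_map cong: image_cong)

lemma openin_below: "a \<in> carrier A \<Longrightarrow> openin (atom_space A B \<alpha>) (below B (\<alpha> a))"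
  unfolding openin_atom_space by (rule arbitrary_union_of_inc) blast

text \<open>Preimages under \<open>atom_hom A B \<alpha>\<close> are injective on subsets of
  X_\<alpha>, so the maximality condition may be tested on sets of atoms. There
  \<open>s_map A a\<close> turns into \<open>below B (\<alpha> a)\<close>, and the clopen sets into
  those of the pulled-back topology.\<close>

lemma clopens_subtopology_stone_space_iff:
  "clopens (subtopology (stone_space A) (atom_homs A B \<alpha>)) =
      (\<lambda>a. atom_homs A B \<alpha> \<inter> s_map A a) ` carrier A \<longleftrightarrow>
    clopens (atom_space A B \<alpha>) = (\<lambda>a. below B (\<alpha> a)) ` carrier A"
    (is "?\<C> = ?s ` _ \<longleftrightarrow> _ = _")
proof -
  let ?g = "atom_hom A B \<alpha>"
  let ?pre = "\<lambda>V. ?g -` V \<inter> atoms B"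
  have g: "?g ` atoms B \<subseteq> topspace (stone_space A)"
    by (auto simp: topspace_stone_space[OF A] atom_hom_boolean_hom)
  have "inj_on ?pre (Pow (?g ` atoms B))"
    by (rule inj_onI) blast
  moreover have "?\<C> \<subseteq> Pow (?g ` atoms B)"
    by (auto simp: clopens_def atom_homs_def openin_subtopology)
  moreover have "?s ` carrier A \<subseteq> Pow (?g ` atoms B)"
    by (auto simp: atom_homs_def)
  ultimately have "?\<C> = ?s ` carrier A \<longleftrightarrow> ?pre ` ?\<C> = ?pre ` ?s ` carrier A"
    by (rule inj_on_image_eq_iff[symmetric])
  moreover have "?pre (?s a) = below B (\<alpha> a)" if "a \<in> carrier A" for a
    using atom_hom_vimage_s_map[OF that] by (auto simp: atom_homs_def)
  then have "?pre ` ?s ` carrier A = (\<lambda>a. below B (\<alpha> a)) ` carrier A"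
    unfolding image_image by (rule image_cong[OF refl])
  ultimately show ?thesis
    by (simp add: atom_space_def clopens_pullback_topology[OF g] atom_homs_def)
qed

end

lemma mz_map_iff_clopens_atom_space:
  "mz_map A B \<alpha> \<longleftrightarrow> boolean_z_map A B \<alpha> \<and>
    clopens (atom_space A B \<alpha>) = (\<lambda>a. below B (\<alpha> a)) ` carrier A"
  using clopens_subtopology_stone_space_iff[of A B \<alpha>]
  by (auto simp: mz_map_def boolean_z_map_def)

lemma mz_mapD:
  assumes "mz_map A B \<alpha>"
  shows "boolean_lattice A" "caba B" "\<alpha> \<in> boolean_hom A B" "inj_on \<alpha> (carrier A)"
    "clopens (atom_space A B \<alpha>) = (\<lambda>a. below B (\<alpha> a)) ` carrier A"
    "x \<in> atoms B \<Longrightarrow> \<exists>S\<subseteq>\<alpha> ` carrier A. x = \<Sqinter>\<^bsub>B\<^esub> S"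
  using assms by (auto simp: mz_map_iff_clopens_atom_space boolean_z_map_def)

section \<open>Zero-dimensionality and separation\<close>

text \<open>A base of clopen sets may be enlarged to all clopen sets, since these are open too. This
  canonical base is the one that maximality describes.\<close>

lemma zero_dimensional_iff_clopens:
  "zero_dimensional X \<longleftrightarrow> openin X = arbitrary union_of (\<lambda>U. U \<in> clopens X)"
proof
  assume "zero_dimensional X"
  then obtain \<B> where \<B>: "\<B> \<subseteq> clopens X" and base: "openin X = arbitrary union_of (\<lambda>U. U \<in> \<B>)"
    by (auto simp: zero_dimensional_def)
  show "openin X = arbitrary union_of (\<lambda>U. U \<in> clopens X)"
    unfolding openin_topology_base_unique
  proof (intro conjI allI impI)
    show "openin X V" if "V \<in> clopens X" for V using that by (simp add: clopens_def)
    show "\<exists>V. V \<in> clopens X \<and> x \<in> V \<and> V \<subseteq> U" if "openin X U \<and> x \<in> U" for U x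
      using that base \<B> unfolding openin_topology_base_unique by (meson subsetD)
  qed
qed (auto simp: zero_dimensional_def)

lemma zero_dimensional_atom_space: "mz_map A B \<alpha> \<Longrightarrow> zero_dimensional (atom_space A B \<alpha>)"
  by (simp add: zero_dimensional_iff_clopens mz_mapD openin_atom_space)

text \<open>Let \<open>x\<close> be the meet of a set \<open>S\<close> of elements of the image of
  \<open>\<alpha>\<close>. A different atom \<open>y\<close> is not below \<open>x\<close>, hence
  not below some \<open>s\<close> in \<open>S\<close>; the clopen set \<open>below B s\<close> and
  its complement separate the two.\<close>

lemma Hausdorff_atom_space:
  assumes mz: "mz_map A B \<alpha>"
  shows "Hausdorff_space (atom_space A B \<alpha>)"
proof -
  note mzD = mz_mapD[OF mz]
  interpret B: complete_atomic B using mzD(2) by unfold_locales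
  note top = topspace_atom_space[OF mzD(1-3)]
  show ?thesis
    unfolding Hausdorff_space_def top
  proof (intro allI impI, elim conjE)
    fix x y assume x: "x \<in> atoms B" and y: "y \<in> atoms B" and neq: "x \<noteq> y"
    obtain S where S: "S \<subseteq> \<alpha> ` carrier A" "x = \<Sqinter>\<^bsub>B\<^esub> S" using mzD(6)[OF x] by blast
    have SB: "S \<subseteq> carrier B" using S(1) boolean_homD(2)[OF mzD(3)] by blast
    have "y \<notin> below B x" using B.below_atom[OF x] neq by simp
    then obtain s where s: "s \<in> S" "y \<notin> below B s"
      using y B.below_Inf[OF SB] unfolding S(2) by blast
    moreover have "x \<in> below B s"
      using B.below_Inf[OF SB] B.below_atom[OF x] s(1) unfolding S(2)[symmetric] by blast
    moreover have "below B s \<in> clopens (atom_space A B \<alpha>)"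
      using s(1) S(1) mzD(5) by blast
    ultimately show "\<exists>U V. openin (atom_space A B \<alpha>) U \<and> openin (atom_space A B \<alpha>) V \<and>
        x \<in> U \<and> y \<in> V \<and> disjnt U V"
      using y by (intro exI[of _ "below B s"] exI[of _ "atoms B - below B s"])
        (auto simp: clopens_def closedin_def top disjnt_def)
  qed
qed

section \<open>The functor taking a Boolean z-map to its space of atoms\<close>

lemma restrict_id_eq: "restrict id A = (\<lambda>x\<in>A. x)"
  by (simp add: restrict_def fun_eq_iff)

lemma category_ZHaus: "category (ZHaus small)"
proof -
  have maps: "f \<in> topspace X \<rightarrow> topspace Y" if "continuous_map X Y f" for X Y f
    using that by (simp add: continuous_map_def)
  have comp: "continuous_map X Z (compose (topspace X) g f)"
    if "continuous_map X Y f" "continuous_map Y Z g" for X Y Z f g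
    by (rule continuous_map_eq[OF continuous_map_compose[OF that]]) (simp add: compose_eq)
  have ident: "continuous_map X X (\<lambda>x\<in>topspace X. x)" for X
    by (rule continuous_map_eq[OF continuous_map_id]) simp
  show ?thesis
    unfolding category_def ZHaus_def restrict_id_eq
    by (simp add: ident Id_compose maps compose_assoc[symmetric, OF maps])
      (blast intro: comp compose_Id[OF maps])
qed

lemma category_mzMaps: "category (mzMaps small)"
proof -
  have b: "f \<in> carrier A \<rightarrow> carrier B" "f \<in> extensional (carrier A)" if "f \<in> boolean_hom A B" for A B f
    using that by (auto simp: boolean_hom_def PiE_def)
  have c: "f \<in> boolean_hom A B" if "f \<in> complete_boolean_hom A B" for A B f
    using that by (rule complete_boolean_homD(1))
  have idr: "compose (carrier A) f (\<lambda>x\<in>carrier A. x) = f"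
    and idl: "compose (carrier A) (\<lambda>x\<in>carrier B. x) f = f" if "f \<in> boolean_hom A B" for A B f
    using b[OF that] by (rule compose_Id, rule Id_compose)
  note mzD = mz_mapD(1-3)
  show ?thesis
    unfolding category_def
  proof (intro conjI ballI)
    fix X assume "X \<in> Ob (mzMaps small)"
    then obtain A B \<alpha> where X: "X = (A, B, \<alpha>)" and mz: "mz_map A B \<alpha>"
      by (auto simp: mzMaps_def)
    then show "Ident (mzMaps small) X \<in> Hom (mzMaps small) X X"
      using mzD[OF mz] restrict_id_boolean_hom[of A] restrict_id_complete_boolean_hom[of B]
      by (simp add: mzMaps_def restrict_id_eq idr[OF mzD(3)[OF mz]] idl[OF mzD(3)[OF mz]])
  next
    fix X Y Z f g
    assume "X \<in> Ob (mzMaps small)" "Y \<in> Ob (mzMaps small)" "Z \<in> Ob (mzMaps small)"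
      and fg: "f \<in> Hom (mzMaps small) X Y" "g \<in> Hom (mzMaps small) Y Z"
    then obtain A B \<alpha> A' B' \<alpha>' A'' B'' \<alpha>'' \<phi> \<sigma> \<phi>' \<sigma>' where
      XYZ: "X = (A, B, \<alpha>)" "Y = (A', B', \<alpha>')" "Z = (A'', B'', \<alpha>'')" "f = (\<phi>, \<sigma>)" "g = (\<phi>', \<sigma>')"
      and mz: "mz_map A B \<alpha>"
      by (auto simp: mzMaps_def)
    then have \<phi>: "\<phi> \<in> boolean_hom A A'" "\<phi>' \<in> boolean_hom A' A''"
      and \<sigma>: "\<sigma> \<in> complete_boolean_hom B B'" "\<sigma>' \<in> complete_boolean_hom B' B''"
      and comm: "compose (carrier A) \<alpha>' \<phi> = compose (carrier A) \<sigma> \<alpha>"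
        "compose (carrier A') \<alpha>'' \<phi>' = compose (carrier A') \<sigma>' \<alpha>'"
      using fg by (auto simp: mzMaps_def)
    have comm_at: "\<alpha>' (\<phi> a) = \<sigma> (\<alpha> a)" if "a \<in> carrier A" for a
      using that fun_cong[OF comm(1), of a] by (simp add: compose_eq)
    have comm_at': "\<alpha>'' (\<phi>' a) = \<sigma>' (\<alpha>' a)" if "a \<in> carrier A'" for a
      using that fun_cong[OF comm(2), of a] by (simp add: compose_eq)
    \<comment> \<open>The outer rectangle of two commuting squares commutes: both sides send
      \<open>a\<close> to \<open>\<sigma>' (\<sigma> (\<alpha> a))\<close>.\<close>
    have "compose (carrier A) \<alpha>'' (compose (carrier A) \<phi>' \<phi>) =
        compose (carrier A) (compose (carrier B) \<sigma>' \<sigma>) \<alpha>"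
      by (rule extensionalityI[of _ "carrier A"])
        (simp_all add: compose_eq comm_at comm_at' boolean_homD(2)[OF mzD(3)[OF mz]] boolean_homD(2)[OF \<phi>(1)])
    then show "Comp (mzMaps small) X Y Z g f \<in> Hom (mzMaps small) X Z"
      using compose_boolean_hom[OF mzD(1)[OF mz] \<phi>] compose_complete_boolean_hom[OF mzD(2)[OF mz] \<sigma>]
      by (simp add: XYZ mzMaps_def)
  next
    fix X Y f
    assume "X \<in> Ob (mzMaps small)" "Y \<in> Ob (mzMaps small)" "f \<in> Hom (mzMaps small) X Y"
    then show "Comp (mzMaps small) X X Y f (Ident (mzMaps small) X) = f"
      "Comp (mzMaps small) X Y Y (Ident (mzMaps small) Y) f = f"
      by (auto simp: mzMaps_def restrict_id_eq intro: idr idl dest: c)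
  next
    fix W X Y Z f g h
    assume "W \<in> Ob (mzMaps small)" "X \<in> Ob (mzMaps small)" "Y \<in> Ob (mzMaps small)" "Z \<in> Ob (mzMaps small)"
      "f \<in> Hom (mzMaps small) W X" "g \<in> Hom (mzMaps small) X Y" "h \<in> Hom (mzMaps small) Y Z"
    then show "Comp (mzMaps small) W X Z (Comp (mzMaps small) X Y Z h g) f =
        Comp (mzMaps small) W Y Z h (Comp (mzMaps small) W X Y g f)"
      by (auto simp: mzMaps_def compose_assoc[symmetric, OF b(1)] c)
  qed
qed

section \<open>Functoriality of the space of atoms\<close>

text \<open>The functor from mz-maps to spaces, in the role of \<open>G\<close> in
  \<open>dually_equivalentI_fully_faithful\<close>; the functor in the other direction arises from
  it by choice.\<close>

definition atom_functor :: "('u alg_map, ('u \<Rightarrow> 'u) \<times> ('u \<Rightarrow> 'u), 'u topology, 'u \<Rightarrow> 'u) fun_data" where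
  "atom_functor =
     \<lparr> on_ob = (\<lambda>(A, B, \<alpha>). atom_space A B \<alpha>),
       on_hom = (\<lambda>(A, B, \<alpha>) (A', B', \<alpha>') (\<phi>, \<sigma>). atom_map B B' \<sigma>) \<rparr>"

lemma atom_map_extensional: "atom_map B B' \<sigma> \<in> extensional (atoms B')"
  by (simp add: atom_map_def)

lemma atom_map_restrict_id:
  assumes "caba B"
  shows "atom_map B B (restrict id (carrier B)) = (\<lambda>x\<in>atoms B. x)"
proof (rule extensionalityI[of _ "atoms B"])
  interpret complete_atomic B using assms by unfold_locales
  show "atom_map B B (restrict id (carrier B)) x = (\<lambda>x\<in>atoms B. x) x" if "x \<in> atoms B" for x
    using that by (simp add: atom_in_carrier
        atom_map_eq_iff[OF assms assms restrict_id_complete_boolean_hom[OF assms]])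
qed (simp_all add: atom_map_extensional)

text \<open>By \<open>atom_map_eq_iff\<close> it is enough that \<open>x\<close> lies below
  \<open>\<sigma>' (\<sigma> ?z)\<close>. As \<open>\<sigma>'\<close> is a preimage operation, this
  means that \<open>?y\<close> lies below \<open>\<sigma> ?z\<close>, which is the defining property
  of \<open>?z\<close>.\<close>

lemma atom_map_compose:
  assumes B: "caba B" "caba B'" "caba B''"
    and \<sigma>: "\<sigma> \<in> complete_boolean_hom B B'" and \<sigma>': "\<sigma>' \<in> complete_boolean_hom B' B''"
  shows "atom_map B B'' (compose (carrier B) \<sigma>' \<sigma>) = compose (atoms B'') (atom_map B B' \<sigma>) (atom_map B' B'' \<sigma>')"
proof (rule extensionalityI[of _ "atoms B''"])
  fix x assume x: "x \<in> atoms B''"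
  let ?y = "atom_map B' B'' \<sigma>' x" let ?z = "atom_map B B' \<sigma> ?y"
  have y: "?y \<in> atoms B'" by (rule atom_map_in_atoms[OF B(2,3) \<sigma>' x])
  have z: "?z \<in> atoms B" by (rule atom_map_in_atoms[OF B(1,2) \<sigma> y])
  have "?y \<in> below B' (\<sigma> ?z)"
    using y z atom_map_eq_iff[OF B(1,2) \<sigma> y z] by (simp add: below_def)
  moreover have "\<sigma> ?z \<in> carrier B'"
    using boolean_homD(2)[OF complete_boolean_homD(1)[OF \<sigma>]] z by (simp add: atom_in_carrier)
  ultimately have "x \<in> below B'' (\<sigma>' (\<sigma> ?z))"
    using x by (simp add: below_complete_boolean_hom[OF B(2,3) \<sigma>'])
  then have "x \<sqsubseteq>\<^bsub>B''\<^esub> compose (carrier B) \<sigma>' \<sigma> ?z"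
    using z by (simp add: below_def compose_eq atom_in_carrier)
  then have "atom_map B B'' (compose (carrier B) \<sigma>' \<sigma>) x = ?z"
    by (simp add: atom_map_eq_iff[OF B(1,3) compose_complete_boolean_hom[OF B(1) \<sigma> \<sigma>'] x z])
  then show "atom_map B B'' (compose (carrier B) \<sigma>' \<sigma>) x =
      compose (atoms B'') (atom_map B B' \<sigma>) (atom_map B' B'' \<sigma>') x"
    using x by (simp add: compose_eq)
qed (simp_all add: atom_map_extensional)

text \<open>The preimage of the basic set of \<open>a\<close> consists of the atoms below
  \<open>\<sigma> (\<alpha> a)\<close>, which equals \<open>\<alpha>' (\<phi> a)\<close>; so it is
  the basic set of \<open>\<phi> a\<close>.\<close>

lemma continuous_atom_map:
  assumes mz: "mz_map A B \<alpha>" and mz': "mz_map A' B' \<alpha>'"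
    and \<phi>: "\<phi> \<in> boolean_hom A A'" and \<sigma>: "\<sigma> \<in> complete_boolean_hom B B'"
    and comm: "compose (carrier A) \<alpha>' \<phi> = compose (carrier A) \<sigma> \<alpha>"
  shows "continuous_map (atom_space A' B' \<alpha>') (atom_space A B \<alpha>) (atom_map B B' \<sigma>)"
proof -
  note mzD = mz_mapD(1-3)[OF mz] and mzD' = mz_mapD(1-3)[OF mz']
  show ?thesis
    unfolding continuous_map_into_topology_base_eq[OF openin_atom_space[OF mzD]]
      topspace_atom_space[OF mzD] topspace_atom_space[OF mzD']
  proof (intro conjI allI impI)
    show "atom_map B B' \<sigma> \<in> atoms B' \<rightarrow> atoms B"
      by (simp add: atom_map_in_atoms[OF mzD(2) mzD'(2) \<sigma>])
  next
    fix U assume "U \<in> (\<lambda>a. below B (\<alpha> a)) ` carrier A"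
    then obtain a where a: "a \<in> carrier A" "U = below B (\<alpha> a)" by blast
    then have "{x \<in> atoms B'. atom_map B B' \<sigma> x \<in> U} = below B' (\<sigma> (\<alpha> a))"
      by (simp add: below_complete_boolean_hom[OF mzD(2) mzD'(2) \<sigma>] boolean_homD(2)[OF mzD(3)])
    also have "\<dots> = below B' (\<alpha>' (\<phi> a))"
      using fun_cong[OF comm, of a] a(1) by (simp add: compose_eq)
    finally show "openin (atom_space A' B' \<alpha>') {x \<in> atoms B'. atom_map B B' \<sigma> x \<in> U}"
      using openin_below[OF mzD' boolean_homD(2)[OF \<phi> a(1)]] by simp
  qed
qed

lemma contravariant_functor_atom_functor:
  "contravariant_functor (mzMaps small) (ZHaus small) atom_functor"
  unfolding contravariant_functor_def
proof (intro conjI ballI)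
  fix X assume "X \<in> Ob (mzMaps small)"
  then obtain A B \<alpha> where X: "X = (A, B, \<alpha>)" "mz_map A B \<alpha>" "small (atoms B)"
    by (auto simp: mzMaps_def)
  note mzD = mz_mapD(1-3)[OF X(2)]
  show "on_ob atom_functor X \<in> Ob (ZHaus small)"
    using X by (simp add: atom_functor_def ZHaus_def Hausdorff_atom_space zero_dimensional_atom_space
        topspace_atom_space[OF mzD])
  show "on_hom atom_functor X X (Ident (mzMaps small) X) = Ident (ZHaus small) (on_ob atom_functor X)"
    using X(1) by (simp add: atom_functor_def ZHaus_def mzMaps_def atom_map_restrict_id[OF mzD(2), unfolded restrict_id_eq]
        topspace_atom_space[OF mzD] restrict_id_eq)
next
  fix X Y f
  assume "X \<in> Ob (mzMaps small)" "Y \<in> Ob (mzMaps small)" "f \<in> Hom (mzMaps small) X Y"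
  then show "on_hom atom_functor X Y f \<in> Hom (ZHaus small) (on_ob atom_functor Y) (on_ob atom_functor X)"
    by (auto simp: mzMaps_def atom_functor_def ZHaus_def atom_map_extensional
        topspace_atom_space[OF mz_mapD(1-3)] intro: continuous_atom_map)
next
  fix X Y Z f g
  assume "X \<in> Ob (mzMaps small)" "Y \<in> Ob (mzMaps small)" "Z \<in> Ob (mzMaps small)"
    "f \<in> Hom (mzMaps small) X Y" "g \<in> Hom (mzMaps small) Y Z"
  then show "on_hom atom_functor X Z (Comp (mzMaps small) X Y Z g f) =
      Comp (ZHaus small) (on_ob atom_functor Z) (on_ob atom_functor Y) (on_ob atom_functor X)
        (on_hom atom_functor X Y f) (on_hom atom_functor Y Z g)"
    by (auto simp: mzMaps_def atom_functor_def ZHaus_def atom_map_compose mz_mapD(2)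
        topspace_atom_space[OF mz_mapD(1-3)])
qed

section \<open>Full faithfulness\<close>

lemma atom_map_inject:
  assumes "caba B" "caba B'" "\<sigma> \<in> complete_boolean_hom B B'" "\<tau> \<in> complete_boolean_hom B B'"
    and eq: "atom_map B B' \<sigma> = atom_map B B' \<tau>"
  shows "\<sigma> = \<tau>"
proof (rule extensionalityI[of _ "carrier B"])
  interpret B': complete_atomic B' using assms(2) by unfold_locales
  note \<sigma>D = boolean_homD[OF complete_boolean_homD(1)[OF assms(3)]]
    and \<tau>D = boolean_homD[OF complete_boolean_homD(1)[OF assms(4)]]
  show "\<sigma> \<in> extensional (carrier B)" "\<tau> \<in> extensional (carrier B)" by (rule \<sigma>D \<tau>D)+
  show "\<sigma> b = \<tau> b" if "b \<in> carrier B" for b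
    using that eq by (intro B'.below_inject \<sigma>D \<tau>D)
      (simp_all add: below_complete_boolean_hom[OF assms(1,2,3)] below_complete_boolean_hom[OF assms(1,2,4)])
qed

text \<open>Fullness. Taking preimages under \<open>f\<close> defines \<open>\<sigma>\<close>. By
  continuity it carries clopen sets of atoms to clopen sets, and maximality identifies these with
  the images of \<open>\<alpha>\<close> and \<open>\<alpha>'\<close>; hence
  \<open>\<sigma> \<circ> \<alpha>\<close> factors through the injective \<open>\<alpha>'\<close>,
  which yields \<open>\<phi>\<close>.\<close>

lemma continuous_map_is_atom_map:
  assumes mz: "mz_map A B \<alpha>" and mz': "mz_map A' B' \<alpha>'"
    and f: "continuous_map (atom_space A' B' \<alpha>') (atom_space A B \<alpha>) f" "f \<in> extensional (atoms B')"
  obtains \<phi> \<sigma> where "\<phi> \<in> boolean_hom A A'" "\<sigma> \<in> complete_boolean_hom B B'"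
    "compose (carrier A) \<alpha>' \<phi> = compose (carrier A) \<sigma> \<alpha>" "atom_map B B' \<sigma> = f"
proof -
  note mzD = mz_mapD[OF mz] and mzD' = mz_mapD[OF mz']
  interpret B: complete_atomic B using mzD(2) by unfold_locales
  interpret B': complete_atomic B' using mzD'(2) by unfold_locales
  note top = topspace_atom_space[OF mzD(1-3)] and top' = topspace_atom_space[OF mzD'(1-3)]
  have f_atoms: "f \<in> atoms B' \<rightarrow> atoms B"
    using f(1) by (simp add: continuous_map_def top top')
  define \<sigma> where "\<sigma> = (\<lambda>b\<in>carrier B. \<Squnion>\<^bsub>B'\<^esub> {x \<in> atoms B'. f x \<in> below B b})"
  have below_\<sigma>: "below B' (\<sigma> b) = {x \<in> atoms B'. f x \<in> below B b}" if "b \<in> carrier B" for b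
    using that B'.below_Sup_atoms[of "{x \<in> atoms B'. f x \<in> below B b}"] by (auto simp: \<sigma>_def)
  have "{x \<in> atoms B'. f x \<in> below B b} \<subseteq> carrier B'" for b by (auto simp: atoms_def)
  then have "\<sigma> \<in> carrier B \<rightarrow>\<^sub>E carrier B'" by (simp add: \<sigma>_def)
  then have \<sigma>: "\<sigma> \<in> complete_boolean_hom B B'"
    by (rule complete_boolean_homI_atoms[OF mzD(2) mzD'(2) _ f_atoms below_\<sigma>])
  have "atom_map B B' \<sigma> = f"
  proof (rule extensionalityI[OF _ f(2)])
    fix x assume x: "x \<in> atoms B'"
    then have fx: "f x \<in> atoms B" using f_atoms by blast
    have "x \<in> below B' (\<sigma> (f x))"
      using x fx by (simp add: below_\<sigma> atom_in_carrier B.below_atom)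
    then show "atom_map B B' \<sigma> x = f x"
      by (simp add: atom_map_eq_iff[OF mzD(2) mzD'(2) \<sigma> x fx] below_def)
  qed (simp add: atom_map_extensional)
  moreover have \<sigma>\<alpha>: "compose (carrier A) \<sigma> \<alpha> \<in> boolean_hom A B'"
    by (rule compose_boolean_hom[OF mzD(1,3) complete_boolean_homD(1)[OF \<sigma>]])
  \<comment> \<open>Maximality of \<open>\<alpha>'\<close> enters here: the preimage of
    \<open>below B (\<alpha> a)\<close> is clopen, so it is the set of atoms below
    \<open>\<alpha>' a'\<close> for some \<open>a'\<close>.\<close>
  have "compose (carrier A) \<sigma> \<alpha> ` carrier A \<subseteq> \<alpha>' ` carrier A'"
  proof (rule image_subsetI)
    fix a assume a: "a \<in> carrier A"
    then have \<alpha>a: "\<alpha> a \<in> carrier B" by (rule boolean_homD(2)[OF mzD(3)])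
    have "below B (\<alpha> a) \<in> clopens (atom_space A B \<alpha>)" using a mzD(5) by blast
    then have "{x \<in> atoms B'. f x \<in> below B (\<alpha> a)} \<in> clopens (atom_space A' B' \<alpha>')"
      using openin_continuous_map_preimage[OF f(1)] closedin_continuous_map_preimage[OF f(1)]
      by (simp add: clopens_def top')
    then obtain a' where a': "a' \<in> carrier A'" "below B' (\<sigma> (\<alpha> a)) = below B' (\<alpha>' a')"
      using mzD'(5) below_\<sigma>[OF \<alpha>a] by auto
    have "\<sigma> (\<alpha> a) = \<alpha>' a'"
      by (rule B'.below_inject[OF _ _ a'(2)])
        (use \<alpha>a a'(1) boolean_homD(2)[OF mzD'(3)] boolean_homD(2)[OF complete_boolean_homD(1)[OF \<sigma>]] in auto)
    then show "compose (carrier A) \<sigma> \<alpha> a \<in> \<alpha>' ` carrier A'"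
      using a a'(1) by (simp add: compose_eq)
  qed
  then obtain \<phi> where "\<phi> \<in> boolean_hom A A'" "compose (carrier A) \<alpha>' \<phi> = compose (carrier A) \<sigma> \<alpha>"
    using boolean_hom_through_injective[OF mzD(1) mzD'(1) \<sigma>\<alpha> mzD'(3,4)] by blast
  ultimately show thesis using \<sigma> that by blast
qed

lemma bij_betw_atom_functor:
  assumes "X \<in> Ob (mzMaps small)" "Y \<in> Ob (mzMaps small)"
  shows "bij_betw (on_hom atom_functor X Y) (Hom (mzMaps small) X Y)
    (Hom (ZHaus small) (on_ob atom_functor Y) (on_ob atom_functor X))"
proof -
  obtain A B \<alpha> A' B' \<alpha>' where X: "X = (A, B, \<alpha>)" and Y: "Y = (A', B', \<alpha>')"
    and mz: "mz_map A B \<alpha>" and mz': "mz_map A' B' \<alpha>'"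
    using assms by (auto simp: mzMaps_def)
  note mzD = mz_mapD[OF mz] and mzD' = mz_mapD[OF mz']
  show ?thesis
  proof (rule bij_betw_imageI)
    show "inj_on (on_hom atom_functor X Y) (Hom (mzMaps small) X Y)"
    proof (rule inj_onI)
      fix f g assume f: "f \<in> Hom (mzMaps small) X Y" and g: "g \<in> Hom (mzMaps small) X Y"
        and eq: "on_hom atom_functor X Y f = on_hom atom_functor X Y g"
      obtain \<phi> \<sigma> \<psi> \<tau> where fg: "f = (\<phi>, \<sigma>)" "g = (\<psi>, \<tau>)" by (cases f, cases g) blast
      have \<phi>: "\<phi> \<in> boolean_hom A A'" "\<psi> \<in> boolean_hom A A'"
        and \<sigma>: "\<sigma> \<in> complete_boolean_hom B B'" "\<tau> \<in> complete_boolean_hom B B'"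
        and comm: "compose (carrier A) \<alpha>' \<phi> = compose (carrier A) \<sigma> \<alpha>"
          "compose (carrier A) \<alpha>' \<psi> = compose (carrier A) \<tau> \<alpha>"
        using f g by (simp_all add: X Y fg mzMaps_def)
      have "\<sigma> = \<tau>"
        using eq by (intro atom_map_inject[OF mzD(2) mzD'(2) \<sigma>]) (simp add: X Y fg atom_functor_def)
      moreover have "\<phi> = \<psi>"
      proof (rule extensionalityI[of _ "carrier A"])
        show "\<phi> a = \<psi> a" if a: "a \<in> carrier A" for a
        proof (rule inj_onD[OF mzD'(4)])
          show "\<alpha>' (\<phi> a) = \<alpha>' (\<psi> a)"
            using fun_cong[OF comm(1), of a] fun_cong[OF comm(2), of a] a \<open>\<sigma> = \<tau>\<close> by (simp add: compose_eq)
        qed (use a boolean_homD(2)[OF \<phi>(1)] boolean_homD(2)[OF \<phi>(2)] in auto)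
      qed (rule boolean_homD(1)[OF \<phi>(1)] boolean_homD(1)[OF \<phi>(2)])+
      ultimately show "f = g" by (simp add: fg)
    qed
    show "on_hom atom_functor X Y ` Hom (mzMaps small) X Y =
        Hom (ZHaus small) (on_ob atom_functor Y) (on_ob atom_functor X)"
    proof (intro subset_antisym subsetI)
      fix f assume "f \<in> Hom (ZHaus small) (on_ob atom_functor Y) (on_ob atom_functor X)"
      then have "continuous_map (atom_space A' B' \<alpha>') (atom_space A B \<alpha>) f" "f \<in> extensional (atoms B')"
        by (simp_all add: X Y atom_functor_def ZHaus_def topspace_atom_space[OF mzD'(1-3)])
      then obtain \<phi> \<sigma> where "(\<phi>, \<sigma>) \<in> Hom (mzMaps small) X Y" "atom_map B B' \<sigma> = f"
        by (rule continuous_map_is_atom_map[OF mz mz']) (simp add: X Y mzMaps_def)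
      then show "f \<in> on_hom atom_functor X Y ` Hom (mzMaps small) X Y"
        by (intro image_eqI[of _ _ "(\<phi>, \<sigma>)"]) (simp_all add: X Y atom_functor_def)
    next
      fix h assume "h \<in> on_hom atom_functor X Y ` Hom (mzMaps small) X Y"
      then show "h \<in> Hom (ZHaus small) (on_ob atom_functor Y) (on_ob atom_functor X)"
        using contravariant_functor_Hom[OF contravariant_functor_atom_functor assms] by blast
    qed
  qed
qed

section \<open>The Boolean z-map of clopen sets\<close>

text \<open>The renaming \<open>e\<close> moves algebras of sets of points back into the type of points, where the
  objects of \<^const>\<open>mzMaps\<close> live.\<close>

definition set_lattice :: "('a set \<Rightarrow> 'u) \<Rightarrow> 'a set set \<Rightarrow> 'u gorder" where
  "set_lattice e M =
     \<lparr> carrier = e ` M, eq = (=), le = (\<lambda>u v. \<exists>S\<in>M. \<exists>T\<in>M. u = e S \<and> v = e T \<and> S \<subseteq> T) \<rparr>"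

lemma carrier_set_lattice: "carrier (set_lattice e M) = e ` M"
  by (simp add: set_lattice_def)

lemma eq_set_lattice: "(.=\<^bsub>set_lattice e M\<^esub>) = (=)"
  by (simp add: set_lattice_def)

section \<open>Boolean algebras from renamed algebras of sets\<close>

context algebra
begin

context
  fixes e :: "'a set \<Rightarrow> 'u"
  assumes e: "inj_on e M"
begin

lemma set_lattice_le_iff:
  "\<lbrakk>S \<in> M; T \<in> M\<rbrakk> \<Longrightarrow> e S \<sqsubseteq>\<^bsub>set_lattice e M\<^esub> e T \<longleftrightarrow> S \<subseteq> T"
  by (auto simp: set_lattice_def dest: inj_onD[OF e])

lemma partial_order_set_lattice: "partial_order (set_lattice e M)"
proof
  show "x \<sqsubseteq>\<^bsub>set_lattice e M\<^esub> z"
    if "x \<sqsubseteq>\<^bsub>set_lattice e M\<^esub> y" "y \<sqsubseteq>\<^bsub>set_lattice e M\<^esub> z"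
      "x \<in> carrier (set_lattice e M)" "y \<in> carrier (set_lattice e M)" "z \<in> carrier (set_lattice e M)"
    for x y z
    using that by (force simp: carrier_set_lattice set_lattice_le_iff)
qed (auto simp: set_lattice_le_iff carrier_set_lattice eq_set_lattice)

interpretation partial_order "set_lattice e M"
  by (rule partial_order_set_lattice)

text \<open>An algebra of sets need not contain infinite unions, so membership of the union is
  assumed. This serves both pairs in any algebra and arbitrary families in a power set.\<close>

lemma is_lub_set_lattice:
  assumes "\<D> \<subseteq> M" "\<Union>\<D> \<in> M"
  shows "is_lub (set_lattice e M) (e (\<Union>\<D>)) (e ` \<D>)"
proof (rule least_UpperI)
  fix u assume "u \<in> Upper (set_lattice e M) (e ` \<D>)"
  then have "u \<in> e ` M" and *: "\<And>T. T \<in> \<D> \<Longrightarrow> e T \<sqsubseteq>\<^bsub>set_lattice e M\<^esub> u"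
    using assms(1) by (force simp: Upper_def carrier_set_lattice)+
  then obtain S where S: "S \<in> M" "u = e S" by blast
  with * have "T \<subseteq> S" if "T \<in> \<D>" for T
    using that assms(1) set_lattice_le_iff by blast
  then show "e (\<Union>\<D>) \<sqsubseteq>\<^bsub>set_lattice e M\<^esub> u"
    using S(1,2) assms(2) by (auto simp: set_lattice_le_iff)
next
  fix u assume "u \<in> e ` \<D>"
  then show "u \<sqsubseteq>\<^bsub>set_lattice e M\<^esub> e (\<Union>\<D>)"
    using assms by (auto simp: set_lattice_le_iff subset_iff)
qed (use assms in \<open>auto simp: carrier_set_lattice\<close>)

text \<open>Intersecting with \<open>\<Omega>\<close> gives the empty family its proper infimum, the
  top element, where \<open>\<Inter>{}\<close> alone would be \<open>UNIV\<close>.\<close>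

lemma is_glb_set_lattice:
  assumes "\<D> \<subseteq> M" "\<Omega> \<inter> \<Inter>\<D> \<in> M"
  shows "is_glb (set_lattice e M) (e (\<Omega> \<inter> \<Inter>\<D>)) (e ` \<D>)"
proof (rule greatest_LowerI)
  fix u assume "u \<in> Lower (set_lattice e M) (e ` \<D>)"
  then have "u \<in> e ` M" and *: "\<And>T. T \<in> \<D> \<Longrightarrow> u \<sqsubseteq>\<^bsub>set_lattice e M\<^esub> e T"
    using assms(1) by (force simp: Lower_def carrier_set_lattice)+
  then obtain S where S: "S \<in> M" "u = e S" by blast
  with * have "S \<subseteq> T" if "T \<in> \<D>" for T
    using that assms(1) set_lattice_le_iff by blast
  then show "u \<sqsubseteq>\<^bsub>set_lattice e M\<^esub> e (\<Omega> \<inter> \<Inter>\<D>)"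
    using S(1,2) assms(2) sets_into_space by (auto simp: set_lattice_le_iff)
next
  fix u assume "u \<in> e ` \<D>"
  then show "e (\<Omega> \<inter> \<Inter>\<D>) \<sqsubseteq>\<^bsub>set_lattice e M\<^esub> u"
    using assms by (auto simp: set_lattice_le_iff subset_iff)
qed (use assms in \<open>auto simp: carrier_set_lattice set_lattice_le_iff\<close>)

lemma sup_set_lattice:
  assumes "\<D> \<subseteq> M" "\<Union>\<D> \<in> M"
  shows "\<Squnion>\<^bsub>set_lattice e M\<^esub> (e ` \<D>) = e (\<Union>\<D>)"
  unfolding sup_def using is_lub_set_lattice[OF assms] by (blast intro: some_equality least_unique)

lemma inf_set_lattice:
  assumes "\<D> \<subseteq> M" "\<Omega> \<inter> \<Inter>\<D> \<in> M"
  shows "\<Sqinter>\<^bsub>set_lattice e M\<^esub> (e ` \<D>) = e (\<Omega> \<inter> \<Inter>\<D>)"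
  unfolding inf_def using is_glb_set_lattice[OF assms] by (blast intro: some_equality greatest_unique)

lemma join_set_lattice: "\<lbrakk>S \<in> M; T \<in> M\<rbrakk> \<Longrightarrow> e S \<squnion>\<^bsub>set_lattice e M\<^esub> e T = e (S \<union> T)"
  using sup_set_lattice[of "{S, T}"] by (auto simp: join_def)

lemma meet_set_lattice: "\<lbrakk>S \<in> M; T \<in> M\<rbrakk> \<Longrightarrow> e S \<sqinter>\<^bsub>set_lattice e M\<^esub> e T = e (S \<inter> T)"
  using inf_set_lattice[of "{S, T}"] sets_into_space[of S]
  by (auto simp: meet_def Int_absorb1 simp flip: Int_assoc)

lemma least_set_lattice: "least (set_lattice e M) (e {}) (carrier (set_lattice e M))"
  by (auto simp: least_def carrier_set_lattice set_lattice_le_iff)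

lemma greatest_set_lattice: "greatest (set_lattice e M) (e \<Omega>) (carrier (set_lattice e M))"
  using sets_into_space by (auto simp: greatest_def carrier_set_lattice set_lattice_le_iff)

lemma bottom_set_lattice: "\<bottom>\<^bsub>set_lattice e M\<^esub> = e {}"
  unfolding bottom_def using least_set_lattice by (blast intro: some_equality least_unique)

lemma top_set_lattice: "\<top>\<^bsub>set_lattice e M\<^esub> = e \<Omega>"
  unfolding top_def using greatest_set_lattice by (blast intro: some_equality greatest_unique)

lemma boolean_lattice_set_lattice: "boolean_lattice (set_lattice e M)"
proof
  fix x y assume "x \<in> carrier (set_lattice e M)" "y \<in> carrier (set_lattice e M)"
  then obtain S T where ST: "S \<in> M" "T \<in> M" "x = e S" "y = e T"
    by (auto simp: carrier_set_lattice)
  show "\<exists>s. is_lub (set_lattice e M) s {x, y}"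
    using ST is_lub_set_lattice[of "{S, T}"] by auto
  show "\<exists>s. is_glb (set_lattice e M) s {x, y}"
    using ST is_glb_set_lattice[of "{S, T}"] by auto
next
  show "\<exists>x. least (set_lattice e M) x (carrier (set_lattice e M))"
    using least_set_lattice by blast
  show "\<exists>x. greatest (set_lattice e M) x (carrier (set_lattice e M))"
    using greatest_set_lattice by blast
next
  show "x \<sqinter>\<^bsub>set_lattice e M\<^esub> (y \<squnion>\<^bsub>set_lattice e M\<^esub> z) =
      (x \<sqinter>\<^bsub>set_lattice e M\<^esub> y) \<squnion>\<^bsub>set_lattice e M\<^esub> (x \<sqinter>\<^bsub>set_lattice e M\<^esub> z)"
    if "x \<in> carrier (set_lattice e M)" "y \<in> carrier (set_lattice e M)" "z \<in> carrier (set_lattice e M)"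
    for x y z
    using that by (auto simp: carrier_set_lattice join_set_lattice meet_set_lattice Un Int Int_Un_distrib)
next
  fix x assume "x \<in> carrier (set_lattice e M)"
  then obtain S where S: "S \<in> M" "x = e S" by (auto simp: carrier_set_lattice)
  then show "\<exists>y\<in>carrier (set_lattice e M). x \<sqinter>\<^bsub>set_lattice e M\<^esub> y = \<bottom>\<^bsub>set_lattice e M\<^esub> \<and>
      x \<squnion>\<^bsub>set_lattice e M\<^esub> y = \<top>\<^bsub>set_lattice e M\<^esub>"
    using sets_into_space[of S] by (intro bexI[of _ "e (\<Omega> - S)"])
      (auto simp: carrier_set_lattice join_set_lattice meet_set_lattice bottom_set_lattice top_set_lattice compl_sets Un_absorb1)
qed

text \<open>Both lattices use the same renaming \<open>e\<close> and compute with unions and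
  intersections of sets, so the inclusion of set algebras becomes the identity on renamed
  elements.\<close>

lemma restrict_id_boolean_hom_set_lattice:
  assumes N: "algebra \<Omega> N" "N \<subseteq> M"
  shows "restrict id (e ` N) \<in> boolean_hom (set_lattice e N) (set_lattice e M)"
proof -
  interpret N: algebra \<Omega> N by (rule N)
  have eN: "inj_on e N" using e N(2) by (rule inj_on_subset)
  have "S \<in> M" if "S \<in> N" for S using that N(2) by blast
  then show ?thesis
    by (auto simp: boolean_hom_def carrier_set_lattice bottom_set_lattice top_set_lattice
        meet_set_lattice join_set_lattice N.bottom_set_lattice[OF eN] N.top_set_lattice[OF eN]
        N.meet_set_lattice[OF eN] N.join_set_lattice[OF eN] N.Un N.Int)
qed

end

end

section \<open>Renamed power sets as complete atomic Boolean algebras\<close>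

context
  fixes e :: "'a set \<Rightarrow> 'u" and X :: "'a set"
  assumes e: "inj_on e (Pow X)"
begin

interpretation algebra X "Pow X" by (rule algebra_Pow)

lemma atoms_set_lattice_Pow: "atoms (set_lattice e (Pow X)) = (\<lambda>x. e {x}) ` X"
proof -
  have *: "e S \<in> atoms (set_lattice e (Pow X)) \<longleftrightarrow> (\<exists>x\<in>X. S = {x})" if S: "S \<subseteq> X" for S
  proof -
    have "e S \<in> atoms (set_lattice e (Pow X)) \<longleftrightarrow> S \<noteq> {} \<and> (\<forall>T\<subseteq>S. T = {} \<or> T = S)"
      using S inj_onD[OF e] by (auto simp: atoms_def carrier_set_lattice bottom_set_lattice[OF e]
          set_lattice_le_iff[OF e] inj_on_eq_iff[OF e])
    also have "\<dots> \<longleftrightarrow> (\<exists>x\<in>X. S = {x})"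
      using S by (auto simp: subset_singleton_iff)
    finally show ?thesis .
  qed
  show ?thesis
  proof (intro subset_antisym subsetI)
    fix u assume u: "u \<in> atoms (set_lattice e (Pow X))"
    then obtain S where "S \<subseteq> X" "u = e S" by (auto simp: atoms_def carrier_set_lattice)
    then show "u \<in> (\<lambda>x. e {x}) ` X" using u *[of S] by blast
  qed (use * in auto)
qed

lemma below_set_lattice_Pow:
  assumes "S \<subseteq> X"
  shows "below (set_lattice e (Pow X)) (e S) = (\<lambda>x. e {x}) ` S"
proof -
  have "e {x} \<sqsubseteq>\<^bsub>set_lattice e (Pow X)\<^esub> e S \<longleftrightarrow> x \<in> S" if "x \<in> X" for x
    using that assms set_lattice_le_iff[OF e, of "{x}" S] by simp
  then show ?thesis
    using assms by (auto simp: below_def atoms_set_lattice_Pow)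
qed

lemma caba_set_lattice_Pow: "caba (set_lattice e (Pow X))"
  unfolding caba_def
proof (intro conjI ballI impI)
  show "boolean_lattice (set_lattice e (Pow X))"
    by (rule boolean_lattice_set_lattice[OF e])
  show "complete_lattice (set_lattice e (Pow X))"
  proof (rule partial_order.complete_latticeI[OF partial_order_set_lattice[OF e]])
    fix S assume "S \<subseteq> carrier (set_lattice e (Pow X))"
    then obtain \<D> where "\<D> \<subseteq> Pow X" "S = e ` \<D>"
      by (auto simp: carrier_set_lattice subset_image_iff)
    then show "\<exists>s. is_lub (set_lattice e (Pow X)) s S" "\<exists>s. is_glb (set_lattice e (Pow X)) s S"
      using is_lub_set_lattice[OF e, of \<D>] is_glb_set_lattice[OF e, of \<D>] by auto
  qed
  fix b assume "b \<in> carrier (set_lattice e (Pow X))" "b \<noteq> \<bottom>\<^bsub>set_lattice e (Pow X)\<^esub>"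
  then obtain S where "S \<subseteq> X" "b = e S" "S \<noteq> {}"
    by (auto simp: carrier_set_lattice bottom_set_lattice[OF e])
  moreover from this obtain x where "x \<in> S" by blast
  ultimately have "e {x} \<in> below (set_lattice e (Pow X)) b"
    by (auto simp: below_set_lattice_Pow)
  then show "\<exists>x\<in>atoms (set_lattice e (Pow X)). x \<sqsubseteq>\<^bsub>set_lattice e (Pow X)\<^esub> b"
    by (auto simp: below_def)
qed

end

section \<open>Recovering a space from its clopen sets\<close>

lemma clopens_homeomorphic_image:
  assumes "homeomorphic_map X Y f"
  shows "clopens Y = (`) f ` clopens X"
proof (intro subset_antisym subsetI)
  fix V assume V: "V \<in> clopens Y"
  then have "V \<subseteq> f ` topspace X"
    using assms openin_subset by (auto simp: clopens_def homeomorphic_imp_surjective_map)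
  then obtain U where "U \<subseteq> topspace X" "V = f ` U" by (auto simp: subset_image_iff)
  with V show "V \<in> (`) f ` clopens X"
    using assms by (auto simp: clopens_def homeomorphic_map_openness homeomorphic_map_closedness)
next
  fix V assume "V \<in> (`) f ` clopens X"
  then show "V \<in> clopens Y"
    using assms by (auto simp: clopens_def homeomorphic_map_openness_eq[OF assms] homeomorphic_map_closedness_eq[OF assms])
qed

lemma algebra_clopens: "algebra (topspace X) (clopens X)"
  unfolding algebra_iff_Un clopens_def by (auto dest: openin_subset)

abbreviation clopen_lattice :: "('a set \<Rightarrow> 'u) \<Rightarrow> 'a topology \<Rightarrow> 'u gorder" where
  "clopen_lattice e X \<equiv> set_lattice e (clopens X)"

abbreviation subset_lattice :: "('a set \<Rightarrow> 'u) \<Rightarrow> 'a topology \<Rightarrow> 'u gorder" where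
  "subset_lattice e X \<equiv> set_lattice e (Pow (topspace X))"

abbreviation clopen_inclusion :: "('a set \<Rightarrow> 'u) \<Rightarrow> 'a topology \<Rightarrow> 'u \<Rightarrow> 'u" where
  "clopen_inclusion e X \<equiv> restrict id (e ` clopens X)"

abbreviation clopen_space :: "('a set \<Rightarrow> 'u) \<Rightarrow> 'a topology \<Rightarrow> 'u topology" where
  "clopen_space e X \<equiv> atom_space (clopen_lattice e X) (subset_lattice e X) (clopen_inclusion e X)"

context
  fixes e :: "'a set \<Rightarrow> 'u" and X :: "'a topology"
  assumes e: "inj_on e (Pow (topspace X))"
    and H: "Hausdorff_space X" and zd: "zero_dimensional X"
begin

interpretation P: algebra "topspace X" "Pow (topspace X)" by (rule algebra_Pow)

interpretation C: algebra "topspace X" "clopens X" by (rule algebra_clopens)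

interpretation B: complete_atomic "set_lattice e (Pow (topspace X))"
  by unfold_locales (rule caba_set_lattice_Pow[OF e])

lemma clopens_subset_Pow: "clopens X \<subseteq> Pow (topspace X)"
  using C.space_closed .

text \<open>The essential point is that \<open>{x}\<close> is the intersection of the clopen sets
  containing \<open>x\<close>: a point \<open>y\<close> other than \<open>x\<close> is missed by
  some open neighbourhood of \<open>x\<close>, which contains a clopen neighbourhood of
  \<open>x\<close> by zero-dimensionality.\<close>

lemma boolean_z_map_clopen_map: "boolean_z_map (clopen_lattice e X) (subset_lattice e X) (clopen_inclusion e X)"
  unfolding boolean_z_map_def
proof (intro conjI ballI)
  show "boolean_lattice (clopen_lattice e X)"
    by (rule C.boolean_lattice_set_lattice[OF inj_on_subset[OF e clopens_subset_Pow]])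
  show "caba (subset_lattice e X)" by (rule caba_set_lattice_Pow[OF e])
  show "clopen_inclusion e X \<in> boolean_hom (clopen_lattice e X) (subset_lattice e X)"
    by (rule P.restrict_id_boolean_hom_set_lattice[OF e algebra_clopens clopens_subset_Pow])
  show "inj_on (clopen_inclusion e X) (carrier (clopen_lattice e X))"
    by (simp add: carrier_set_lattice inj_on_def)
  fix u assume "u \<in> atoms (subset_lattice e X)"
  then obtain x where x: "x \<in> topspace X" "u = e {x}"
    by (auto simp: atoms_set_lattice_Pow[OF e])
  let ?\<D> = "{C \<in> clopens X. x \<in> C}"
  have \<D>: "?\<D> \<subseteq> Pow (topspace X)" using clopens_subset_Pow by blast
  have "topspace X \<inter> \<Inter>?\<D> = {x}"
  proof (intro subset_antisym subsetI)
    fix y assume y: "y \<in> topspace X \<inter> \<Inter>?\<D>"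
    show "y \<in> {x}"
    proof (rule ccontr)
      assume "y \<notin> {x}"
      then obtain U where "openin X U" "x \<in> U" "y \<notin> U"
        using H x(1) y unfolding Hausdorff_space_def disjnt_def by (metis IntD1 disjoint_iff singletonI)
      then obtain C where "C \<in> clopens X" "x \<in> C" "C \<subseteq> U"
        using zd unfolding zero_dimensional_iff_clopens openin_topology_base_unique by meson
      then show False using y \<open>y \<notin> U\<close> by blast
    qed
  qed (use x(1) in blast)
  then have "u = \<Sqinter>\<^bsub>subset_lattice e X\<^esub> (e ` ?\<D>)"
    using P.inf_set_lattice[OF e \<D>] x by simp
  moreover have "e ` ?\<D> \<subseteq> clopen_inclusion e X ` carrier (clopen_lattice e X)"
    by (auto simp: carrier_set_lattice)
  ultimately show "\<exists>S\<subseteq>clopen_inclusion e X ` carrier (clopen_lattice e X). u = \<Sqinter>\<^bsub>subset_lattice e X\<^esub> S" by blast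
qed

lemma below_clopen_map:
  "(\<lambda>a. below (subset_lattice e X) (clopen_inclusion e X a)) ` carrier (clopen_lattice e X) = (`) (\<lambda>x. e {x}) ` clopens X"
  unfolding carrier_set_lattice image_image
  by (intro image_cong refl) (use clopens_subset_Pow in \<open>auto simp: below_set_lattice_Pow[OF e]\<close>)

lemma inj_on_singleton: "inj_on (\<lambda>x. e {x}) (topspace X)"
  by (rule inj_onI) (use inj_onD[OF e] in blast)

lemma topspace_clopen_map: "topspace (clopen_space e X) = (\<lambda>x. e {x}) ` topspace X"
  using boolean_z_map_clopen_map
  by (simp add: topspace_atom_space boolean_z_map_def atoms_set_lattice_Pow[OF e])

text \<open>The clopen sets are a base of \<open>X\<close>, and the injection sending
  \<open>x\<close> to \<open>e {x}\<close> carries them onto the defining base of the space of atoms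
  by \<open>below_clopen_map\<close>; so it is continuous and open.\<close>

lemma homeomorphic_map_clopen_map:
  "homeomorphic_map X (clopen_space e X) (\<lambda>x. e {x})"
proof (rule bijective_open_imp_homeomorphic_map)
  note openin_space = openin_atom_space[of "clopen_lattice e X" "subset_lattice e X" "clopen_inclusion e X", unfolded below_clopen_map]
  have base: "openin (clopen_space e X) = arbitrary union_of (\<lambda>U. U \<in> (`) (\<lambda>x. e {x}) ` clopens X)"
    using openin_space boolean_z_map_clopen_map by (simp add: boolean_z_map_def)
  show "continuous_map X (clopen_space e X) (\<lambda>x. e {x})"
    unfolding continuous_map_into_topology_base_eq[OF base] topspace_clopen_map
  proof (intro conjI allI impI)
    fix U assume "U \<in> (`) (\<lambda>x. e {x}) ` clopens X"
    then obtain C where C: "C \<in> clopens X" "U = (\<lambda>x. e {x}) ` C" by blast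
    then have "{x \<in> topspace X. e {x} \<in> U} = C"
      using clopens_subset_Pow inj_onD[OF inj_on_singleton] by blast
    then show "openin X {x \<in> topspace X. e {x} \<in> U}" using C(1) by (simp add: clopens_def)
  qed blast
  show "open_map X (clopen_space e X) (\<lambda>x. e {x})"
    unfolding open_map_def
  proof (intro allI impI)
    fix U assume U: "openin X U"
    show "openin (clopen_space e X) ((\<lambda>x. e {x}) ` U)"
    proof (subst openin_subopen, intro ballI)
      fix u assume "u \<in> (\<lambda>x. e {x}) ` U"
      then obtain x where x: "x \<in> U" "u = e {x}" by blast
      obtain C where C: "C \<in> clopens X" "x \<in> C" "C \<subseteq> U"
        using U x(1) zd unfolding zero_dimensional_iff_clopens openin_topology_base_unique by meson
      then have "openin (clopen_space e X) ((\<lambda>x. e {x}) ` C)"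
        unfolding base by (intro arbitrary_union_of_inc) blast
      then show "\<exists>T. openin (clopen_space e X) T \<and> u \<in> T \<and> T \<subseteq> (\<lambda>x. e {x}) ` U"
        using C(2,3) x(2) by blast
    qed
  qed
qed (simp_all add: topspace_clopen_map inj_on_singleton)

text \<open>Maximality follows from the homeomorphism: the clopen sets of the space of atoms are the
  images of those of \<open>X\<close>, and by \<open>below_clopen_map\<close> these are exactly the
  sets of atoms below elements of the clopen algebra.\<close>

lemma mz_map_clopen_map: "mz_map (clopen_lattice e X) (subset_lattice e X) (clopen_inclusion e X)"
  unfolding mz_map_iff_clopens_atom_space below_clopen_map
  using boolean_z_map_clopen_map clopens_homeomorphic_image[OF homeomorphic_map_clopen_map] by blast

end

section \<open>Essential surjectivity\<close>

lemma atom_functor_essentially_surjective: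
  fixes small :: "'u set \<Rightarrow> bool"
  assumes small: "universe small" and "X \<in> Ob (ZHaus small)"
  shows "\<exists>Y\<in>Ob (mzMaps small). \<exists>f. iso_in (ZHaus small) (on_ob atom_functor Y) X f"
proof -
  have H: "Hausdorff_space X" and zd: "zero_dimensional X" and smallX: "small (topspace X)"
    using assms(2) by (simp_all add: ZHaus_def)
  \<comment> \<open>The universe provides room for the power set of a small point set inside
    \<open>'u\<close>; this is the renaming that puts both algebras among the objects.\<close>
  obtain e :: "'u set \<Rightarrow> 'u" where e: "inj_on e (Pow (topspace X))"
    using small smallX unfolding universe_def lepoll_def by blast
  \<comment> \<open>The atoms are the renamed singletons, at most as many as the points, so they
    form a small set.\<close>
  have "atoms (subset_lattice e X) \<lesssim> topspace X"
    unfolding atoms_set_lattice_Pow[OF e] by (rule image_lepoll)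
  then have "small (atoms (subset_lattice e X))"
    using small smallX unfolding universe_def by blast
  then have Y: "(clopen_lattice e X, subset_lattice e X, clopen_inclusion e X) \<in> Ob (mzMaps small)"
    using mz_map_clopen_map[OF e H zd] by (simp add: mzMaps_def)
  obtain g where "homeomorphic_maps X (clopen_space e X) (\<lambda>x. e {x}) g"
    using homeomorphic_map_clopen_map[OF e H zd] by (auto simp: homeomorphic_map_maps)
  then have j: "continuous_map X (clopen_space e X) (\<lambda>x. e {x})"
    and g: "continuous_map (clopen_space e X) X g"
    and gj: "\<And>x. x \<in> topspace X \<Longrightarrow> g (e {x}) = x"
    and jg: "\<And>u. u \<in> topspace (clopen_space e X) \<Longrightarrow> e {g u} = u"
    by (auto simp: homeomorphic_maps_def)
  have g_top: "g u \<in> topspace X" if "u \<in> topspace (clopen_space e X)" for u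
    using g that by (auto simp: continuous_map_def)
  have j_top: "e {x} \<in> topspace (clopen_space e X)" if "x \<in> topspace X" for x
    using j that by (auto simp: continuous_map_def)
  \<comment> \<open>Arrows are extensional, so the homeomorphism and its inverse are cut down to the
    point sets.\<close>
  let ?g = "restrict g (topspace (clopen_space e X))" and ?j = "\<lambda>x\<in>topspace X. e {x}"
  have "continuous_map (clopen_space e X) X ?g" "continuous_map X (clopen_space e X) ?j"
    using g j by (auto elim: continuous_map_eq)
  moreover have "compose (topspace (clopen_space e X)) ?j ?g = restrict id (topspace (clopen_space e X))"
    by (rule extensionalityI[of _ "topspace (clopen_space e X)"]) (simp_all add: compose_eq g_top jg)
  moreover have "compose (topspace X) ?g ?j = restrict id (topspace X)"
    by (rule extensionalityI[of _ "topspace X"]) (simp_all add: compose_eq j_top gj)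
  ultimately have "iso_in (ZHaus small) (clopen_space e X) X ?g"
    unfolding iso_in_def ZHaus_def by (auto intro!: bexI[of _ ?j])
  then show ?thesis
    using Y by (intro bexI[of _ "(clopen_lattice e X, subset_lattice e X, clopen_inclusion e X)"])
      (auto simp: atom_functor_def)
qed

theorem theorem4p8:
  fixes small :: "'u set \<Rightarrow> bool"
  assumes "universe small"
  shows "dually_equivalent (ZHaus small) (mzMaps small)"
  by (rule dually_equivalentI_fully_faithful[OF category_ZHaus category_mzMaps
        contravariant_functor_atom_functor bij_betw_atom_functor
        atom_functor_essentially_surjective[OF assms]])

end
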